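(* Let $X$, $Y$, $A$ be based spaces satisfying the standing assumptions in the context. Let $\mathrm{ev}_Y\colon\mathrm{map}(X,Y;0)\to Y$ be evaluation at the basepoint $x_0$ of $X$, $\mathrm{ev}_Y(g)=g(x_0)$, and let $\sigma_Y\colon Y\to\mathrm{map}(X,Y;0)$ be its null section, $\sigma_Y(y)=C_y$, where $C_y(x)=y$ for all $x\in X$. Then there is a split short exact sequence of abelian groups $$0\to\mathcal{G}(\Sigma(A\wedge X),Y)\to\mathcal{G}\big(\Sigma A,\mathrm{map}(X,Y;0)\big)\xrightarrow{(\mathrm{ev}_Y)_*}\mathcal{G}(\Sigma A,Y)\to 0,$$ with splitting given by $(\sigma_Y)_*\colon\mathcal{G}(\Sigma A,Y)\to\mathcal{G}\big(\Sigma A,\mathrm{map}(X,Y;0)\big)$.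
   Context: Standing assumptions: $X$, $Y$, $A$ are based spaces that are locally compact, Hausdorff and well-pointed; $X$ and $Y$ are connected, while $A$ may be disconnected (no finiteness or simple connectivity is assumed). $\Sigma$ is reduced suspension, $\wedge$ is smash product. Mapping spaces consist of unbased maps and carry the compact-open topology. $\mathrm{map}(X,Y;0)$ denotes the path component of the null (constant) map in the space of unbased maps $X\to Y$, based at the constant map at the basepoint of $Y$. For a based space $Z$, $\mathrm{aut}_1 Z$ denotes the path component of the identity map $1_Z$ in the space of unbased self-maps of $Z$, based at $1_Z$, and $\omega\colon \mathrm{aut}_1 Z\to Z$ is evaluation at the basepoint of $Z$. $[\Sigma A,Z]$ is the group of based homotopy classes of based maps. The generalized Gottlieb group $\mathcal{G}(\Sigma A, Z)$ is the image of $\omega_*\colon [\Sigma A,\mathrm{aut}_1 Z]\to[\Sigma A,Z]$; it is an abelian subgroup of $[\Sigma A,Z]$. *)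

theory Defs
  imports "HOL-Analysis.Analysis" "HOL-Algebra.Coset"
begin

text \<open>
  The inclusion of \<open>x0\<close> is a cofibration: it has the homotopy extension property.  A definition
  cannot quantify over types, so the test spaces \<open>Z\<close> live on the type \<^typ>\<open>'a \<times> real\<close>, which is large
  enough to contain the mapping cylinder of the inclusion.  Lemma \<open>well_pointed_extension\<close> below
  shows that the property then holds for test spaces on every type.
\<close>

definition well_pointed :: "'a topology \<Rightarrow> 'a \<Rightarrow> bool" where
  "well_pointed X x0 \<longleftrightarrow> x0 \<in> topspace X \<and>
     (\<forall>(Z :: ('a \<times> real) topology) f h.
        continuous_map X Z f \<and> pathin Z h \<and> h 0 = f x0 \<longrightarrow>
        (\<exists>H. continuous_map (prod_topology X (top_of_set {0..1})) Z H \<and>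
             (\<forall>x \<in> topspace X. H (x, 0) = f x) \<and>
             (\<forall>t \<in> {0..1}. H (x0, t) = h t)))"

lemma well_pointed_extension:
  fixes X :: "'a topology" and Z :: "'z topology"
  assumes wp: "well_pointed X x0" and "Hausdorff_space X"
    and f: "continuous_map X Z f" and h: "pathin Z h" and eq: "h 0 = f x0"
  shows "\<exists>H. continuous_map (prod_topology X (top_of_set {0..1})) Z H \<and>
             (\<forall>x \<in> topspace X. H (x, 0) = f x) \<and> (\<forall>t \<in> {0..1}. H (x0, t) = h t)"
proof -
  let ?I = "top_of_set {0..1::real}"
  let ?P = "prod_topology X ?I"
  define T where "T = subtopology ?P (topspace X \<times> {0} \<union> {x0} \<times> {0..1})"
  have x0: "x0 \<in> topspace X"
    using wp by (simp add: well_pointed_def)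
  have i: "continuous_map X T (\<lambda>x. (x, 0))"
    unfolding T_def by (auto simp: continuous_map_in_subtopology continuous_map_pairwise o_def)
  have j: "pathin T (\<lambda>t. (x0, t))"
    unfolding T_def pathin_def using x0
    by (auto simp: continuous_map_in_subtopology continuous_map_pairwise o_def)
  obtain R where R: "continuous_map ?P T R"
      "\<And>x. x \<in> topspace X \<Longrightarrow> R (x, 0) = (x, 0)" "\<And>t. t \<in> {0..1} \<Longrightarrow> R (x0, t) = (x0, t)"
    using wp i j unfolding well_pointed_def by (smt (verit, best))
  define G where "G = (\<lambda>p. if p \<in> topspace X \<times> {0} then f (fst p) else h (snd p))"
  have top: "topspace T = topspace X \<times> {0} \<union> {x0} \<times> {0..1}"
    unfolding T_def using x0 by auto
  have cl0: "closedin ?P (topspace X \<times> {0})"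
    by (auto simp: closedin_prod_Times_iff closedin_subset_topspace intro!: closed_subset)
  have cl1: "closedin ?P ({x0} \<times> {0..1})"
    using \<open>Hausdorff_space X\<close> x0
    by (auto simp: closedin_prod_Times_iff closedin_Hausdorff_singleton)
  have G: "continuous_map T Z G"
  proof (rule pasting_lemma_closed[where I = "{True, False}"
          and T = "\<lambda>b. if b then topspace X \<times> {0} else {x0} \<times> {0..1}"
          and f = "\<lambda>b. if b then f \<circ> fst else h \<circ> snd"])
    show "closedin T (if b then topspace X \<times> {0} else {x0} \<times> {0..1})" for b
      unfolding T_def using cl0 cl1 by (auto intro: closedin_subset_topspace)
    show "continuous_map (subtopology T (if b then topspace X \<times> {0} else {x0} \<times> {0..1})) Z
            (if b then f \<circ> fst else h \<circ> snd)" for b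
    proof (cases b)
      case True
      then show ?thesis
        unfolding T_def subtopology_subtopology using f
        by (auto intro!: continuous_map_from_subtopology continuous_map_compose
              continuous_map_fst)
    next
      case False
      then show ?thesis
        unfolding T_def subtopology_subtopology using h
        by (auto simp: pathin_def intro!: continuous_map_from_subtopology continuous_map_compose
              continuous_map_snd)
    qed
  qed (use eq in \<open>auto simp: G_def top split: if_splits\<close>)
  show ?thesis
  proof (intro exI[of _ "G \<circ> R"] conjI ballI)
    show "continuous_map ?P Z (G \<circ> R)"
      using R(1) G by (rule continuous_map_compose)
  qed (use R eq x0 in \<open>auto simp: G_def\<close>)
qed

text \<open>
  In \<open>X / S\<close> the points of \<open>S\<close> become the single point \<open>S\<close>, and \<open>x \<notin> S\<close> becomes \<open>{x}\<close>.
\<close>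

definition collapse :: "'a set \<Rightarrow> 'a \<Rightarrow> 'a set" where
  "collapse S x = (if x \<in> S then S else {x})"

definition collapse_space :: "'a topology \<Rightarrow> 'a set \<Rightarrow> 'a set topology" where
  "collapse_space X S = topology (\<lambda>U. U \<subseteq> collapse S ` topspace X \<and>
                                       openin X {x \<in> topspace X. collapse S x \<in> U})"

lemma openin_collapse_space:
  "openin (collapse_space X S) U \<longleftrightarrow>
     U \<subseteq> collapse S ` topspace X \<and> openin X {x \<in> topspace X. collapse S x \<in> U}"
proof -
  have "istopology (\<lambda>U. U \<subseteq> collapse S ` topspace X \<and> openin X {x \<in> topspace X. collapse S x \<in> U})"
    unfolding istopology_def
  proof (intro conjI allI impI)
    fix U V
    assume a: "U \<subseteq> collapse S ` topspace X \<and> openin X {x \<in> topspace X. collapse S x \<in> U}"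
      and b: "V \<subseteq> collapse S ` topspace X \<and> openin X {x \<in> topspace X. collapse S x \<in> V}"
    show "U \<inter> V \<subseteq> collapse S ` topspace X" using a by auto
    have "{x \<in> topspace X. collapse S x \<in> U \<inter> V} =
          {x \<in> topspace X. collapse S x \<in> U} \<inter> {x \<in> topspace X. collapse S x \<in> V}" by auto
    then show "openin X {x \<in> topspace X. collapse S x \<in> U \<inter> V}" using a b by auto
  next
    fix \<U>
    assume a: "\<forall>U\<in>\<U>. U \<subseteq> collapse S ` topspace X \<and> openin X {x \<in> topspace X. collapse S x \<in> U}"
    show "\<Union>\<U> \<subseteq> collapse S ` topspace X" using a by blast
    have "{x \<in> topspace X. collapse S x \<in> \<Union>\<U>} =
          \<Union>((\<lambda>U. {x \<in> topspace X. collapse S x \<in> U}) ` \<U>)" by auto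
    then show "openin X {x \<in> topspace X. collapse S x \<in> \<Union>\<U>}" using a by auto
  qed
  then show ?thesis
    by (simp add: collapse_space_def)
qed

lemma quotient_map_collapse: "quotient_map X (collapse_space X S) (collapse S)"
proof -
  have "topspace (collapse_space X S) = collapse S ` topspace X"
  proof
    show "topspace (collapse_space X S) \<subseteq> collapse S ` topspace X"
      using openin_collapse_space openin_topspace by blast
    have "{x \<in> topspace X. collapse S x \<in> collapse S ` topspace X} = topspace X" by auto
    then have "openin (collapse_space X S) (collapse S ` topspace X)"
      by (simp add: openin_collapse_space)
    then show "collapse S ` topspace X \<subseteq> topspace (collapse_space X S)"
      by (rule openin_subset)
  qed
  then show ?thesis
    by (auto simp: quotient_map_def openin_collapse_space)
qed

definition smash_base :: "'a topology \<Rightarrow> 'a \<Rightarrow> 'b topology \<Rightarrow> 'b \<Rightarrow> ('a \<times> 'b) set" where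
  "smash_base A a0 X x0 = topspace A \<times> {x0} \<union> {a0} \<times> topspace X"

definition smash :: "'a topology \<Rightarrow> 'a \<Rightarrow> 'b topology \<Rightarrow> 'b \<Rightarrow> ('a \<times> 'b) set topology" where
  "smash A a0 X x0 = collapse_space (prod_topology A X) (smash_base A a0 X x0)"

definition susp_base :: "'a topology \<Rightarrow> 'a \<Rightarrow> ('a \<times> real) set" where
  "susp_base A a0 = topspace A \<times> {0, 1} \<union> {a0} \<times> {0..1}"

definition susp :: "'a topology \<Rightarrow> 'a \<Rightarrow> ('a \<times> real) set topology" where
  "susp A a0 = collapse_space (prod_topology A (top_of_set {0..1})) (susp_base A a0)"

text \<open>
  Continuous maps are made extensional, so that each one is a single point of the mapping space.
\<close>

definition cmaps :: "'a topology \<Rightarrow> 'b topology \<Rightarrow> ('a \<Rightarrow> 'b) set" where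
  "cmaps X Y = {f \<in> extensional (topspace X). continuous_map X Y f}"

definition compact_open :: "'a topology \<Rightarrow> 'b topology \<Rightarrow> ('a \<Rightarrow> 'b) topology" where
  "compact_open X Y =
     topology_generated_by {{f \<in> cmaps X Y. f ` K \<subseteq> U} | K U. compactin X K \<and> openin Y U}"

lemma topspace_compact_open: "topspace (compact_open X Y) = cmaps X Y"
proof -
  have "cmaps X Y \<in> {{f \<in> cmaps X Y. f ` K \<subseteq> U} | K U. compactin X K \<and> openin Y U}"
    by (rule CollectI, rule exI[of _ "{}"], rule exI[of _ "{}"]) auto
  then show ?thesis
    unfolding compact_open_def topology_generated_by_topspace by blast
qed

definition const_map :: "'a topology \<Rightarrow> 'b \<Rightarrow> 'a \<Rightarrow> 'b" where
  "const_map X y = (\<lambda>x \<in> topspace X. y)"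

definition map_null :: "'a topology \<Rightarrow> 'b topology \<Rightarrow> 'b \<Rightarrow> ('a \<Rightarrow> 'b) topology" where
  "map_null X Y y0 = subtopology (compact_open X Y)
     (path_component_of_set (compact_open X Y) (const_map X y0))"

definition id_map :: "'a topology \<Rightarrow> 'a \<Rightarrow> 'a" where
  "id_map Z = (\<lambda>z \<in> topspace Z. z)"

definition aut1 :: "'a topology \<Rightarrow> ('a \<Rightarrow> 'a) topology" where
  "aut1 Z = subtopology (compact_open Z Z)
     (path_component_of_set (compact_open Z Z) (id_map Z))"

definition based_maps :: "'a topology \<Rightarrow> 'a \<Rightarrow> 'b topology \<Rightarrow> 'b \<Rightarrow> ('a \<Rightarrow> 'b) set" where
  "based_maps W w0 Z z0 = {f. continuous_map W Z f \<and> f w0 = z0}"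

definition hclass :: "'a topology \<Rightarrow> 'a \<Rightarrow> 'b topology \<Rightarrow> 'b \<Rightarrow> ('a \<Rightarrow> 'b) \<Rightarrow> ('a \<Rightarrow> 'b) set" where
  "hclass W w0 Z z0 f = {g. homotopic_with (\<lambda>h. h w0 = z0) W Z f g}"

definition hclasses :: "'a topology \<Rightarrow> 'a \<Rightarrow> 'b topology \<Rightarrow> 'b \<Rightarrow> ('a \<Rightarrow> 'b) set set" where
  "hclasses W w0 Z z0 = hclass W w0 Z z0 ` based_maps W w0 Z z0"

text \<open>
  The map \<open>[W, Z] \<rightarrow> [W, Z']\<close> induced by a based map \<open>\<phi> : Z \<rightarrow> Z'\<close>; all \<open>f\<close> in one homotopy class
  contribute the same class, so the union is just that class.
\<close>

definition induced ::
    "'a topology \<Rightarrow> 'a \<Rightarrow> 'c topology \<Rightarrow> 'c \<Rightarrow> ('b \<Rightarrow> 'c) \<Rightarrow> ('a \<Rightarrow> 'b) set \<Rightarrow> ('a \<Rightarrow> 'c) set" where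
  "induced W w0 Z' z0' \<phi> F = (\<Union>f \<in> F. hclass W w0 Z' z0' (\<phi> \<circ> f))"

lemma induced_hclass:
  assumes "continuous_map Z Z' \<phi>" "\<phi> z0 = z0'" "f \<in> based_maps W w0 Z z0"
  shows "induced W w0 Z' z0' \<phi> (hclass W w0 Z z0 f) = hclass W w0 Z' z0' (\<phi> \<circ> f)"
proof -
  have *: "homotopic_with (\<lambda>h. h w0 = z0') W Z' (\<phi> \<circ> f) (\<phi> \<circ> g)" if "g \<in> hclass W w0 Z z0 f" for g
    using that assms(1,2) unfolding hclass_def
    by (auto intro: homotopic_with_compose_continuous_map_left)
  have "f \<in> hclass W w0 Z z0 f"
    using assms(3) by (simp add: hclass_def based_maps_def homotopic_with_refl)
  with * show ?thesis
    unfolding induced_def hclass_def by (blast intro: homotopic_with_trans)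
qed

text \<open>
  A point \<open>p\<close> of the suspension is an equivalence class; lemma \<open>susp_add_collapse\<close> shows that, for based
  maps, the value does not depend on the chosen representative.
\<close>

definition susp_add ::
    "'a topology \<Rightarrow> 'a \<Rightarrow> (('a \<times> real) set \<Rightarrow> 'b) \<Rightarrow> (('a \<times> real) set \<Rightarrow> 'b) \<Rightarrow> ('a \<times> real) set \<Rightarrow> 'b"
  where
  "susp_add A a0 f g p =
     (let (a, t) = (SOME q. q \<in> p)
      in if t \<le> 1/2 then f (collapse (susp_base A a0) (a, 2 * t))
         else g (collapse (susp_base A a0) (a, 2 * t - 1)))"

lemma susp_add_collapse:
  assumes "f (susp_base A a0) = z0" "g (susp_base A a0) = z0"
    and "a \<in> topspace A" "t \<in> {0..1}"
  shows "susp_add A a0 f g (collapse (susp_base A a0) (a, t)) =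
     (if t \<le> 1/2 then f (collapse (susp_base A a0) (a, 2 * t))
      else g (collapse (susp_base A a0) (a, 2 * t - 1)))"
proof -
  let ?S = "susp_base A a0"
  let ?c = "collapse ?S"
  let ?v = "\<lambda>q. if snd q \<le> 1/2 then f (?c (fst q, 2 * snd q)) else g (?c (fst q, 2 * snd q - 1))"
  have S: "?v q = z0" if "q \<in> ?S" for q
  proof -
    have "snd q \<le> 1/2 \<Longrightarrow> (fst q, 2 * snd q) \<in> ?S" "\<not> snd q \<le> 1/2 \<Longrightarrow> (fst q, 2 * snd q - 1) \<in> ?S"
      using that unfolding susp_base_def by auto
    then show ?thesis using assms(1,2) by (auto simp: collapse_def)
  qed
  define q where "q = (SOME q. q \<in> ?c (a, t))"
  have q: "q \<in> ?c (a, t)"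
    unfolding q_def by (rule someI[of _ "(a, t)"]) (simp add: collapse_def)
  have "?v q = ?v (a, t)"
  proof (cases "(a, t) \<in> ?S")
    case True
    then have "q \<in> ?S" using q by (simp add: collapse_def)
    then show ?thesis using S True by metis
  next
    case False
    then show ?thesis using q by (simp add: collapse_def)
  qed
  then show ?thesis
    by (simp add: susp_add_def q_def[symmetric] case_prod_beta)
qed

definition susp_group ::
    "'a topology \<Rightarrow> 'a \<Rightarrow> 'b topology \<Rightarrow> 'b \<Rightarrow> (('a \<times> real) set \<Rightarrow> 'b) set monoid" where
  "susp_group A a0 Z z0 =
     \<lparr>carrier = hclasses (susp A a0) (susp_base A a0) Z z0,
      mult = (\<lambda>F G. \<Union>f \<in> F. \<Union>g \<in> G. hclass (susp A a0) (susp_base A a0) Z z0 (susp_add A a0 f g)),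
      one = hclass (susp A a0) (susp_base A a0) Z z0 (\<lambda>_. z0)\<rparr>"

definition susp_induced ::
    "'a topology \<Rightarrow> 'a \<Rightarrow> 'c topology \<Rightarrow> 'c \<Rightarrow> ('b \<Rightarrow> 'c)
       \<Rightarrow> (('a \<times> real) set \<Rightarrow> 'b) set \<Rightarrow> (('a \<times> real) set \<Rightarrow> 'c) set" where
  "susp_induced A a0 = induced (susp A a0) (susp_base A a0)"

text \<open>
  The carrier is the image of \<open>\<omega>\<^sub>*\<close>, where \<open>\<omega>\<close> is the evaluation \<open>\<lambda>g. g z0\<close>; the operations are those of
  \<open>[\<Sigma>A, Z]\<close>.
\<close>

definition gottlieb ::
    "'a topology \<Rightarrow> 'a \<Rightarrow> 'b topology \<Rightarrow> 'b \<Rightarrow> (('a \<times> real) set \<Rightarrow> 'b) set monoid" where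
  "gottlieb A a0 Z z0 = (susp_group A a0 Z z0)
     \<lparr>carrier := susp_induced A a0 Z z0 (\<lambda>g. g z0) `
                   carrier (susp_group A a0 (aut1 Z) (id_map Z))\<rparr>"

text \<open>The sequence is \<open>0 \<rightarrow> G \<rightarrow> H \<rightarrow> K \<rightarrow> 0\<close> with maps \<open>i\<close>, \<open>p\<close>, split by \<open>s : K \<rightarrow> H\<close>.\<close>

definition split_short_exact ::
    "('a, 'm) monoid_scheme \<Rightarrow> ('b, 'n) monoid_scheme \<Rightarrow> ('c, 'k) monoid_scheme
       \<Rightarrow> ('a \<Rightarrow> 'b) \<Rightarrow> ('b \<Rightarrow> 'c) \<Rightarrow> ('c \<Rightarrow> 'b) \<Rightarrow> bool" where
  "split_short_exact G H K i p s \<longleftrightarrow>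
     i \<in> mon G H \<and> p \<in> epi H K \<and> i ` carrier G = kernel H K p \<and>
     s \<in> hom K H \<and> (\<forall>c \<in> carrier K. p (s c) = c)"

end

theory Submission
  imports Defs
begin

text \<open>
  A based map from \<open>\<Sigma>A\<close> to \<open>Z\<close> is a family of loops \<open>u : A \<times> I \<rightarrow> Z\<close> that is constant on the subspace
  collapsed in \<open>\<Sigma>A\<close>.  Likewise a based map from \<open>\<Sigma>(A \<and> X)\<close> is such a family on \<open>(A \<times> X) \<times> I\<close>, so the
  smash product enters only through the subspace that it collapses.  A family represents a Gottlieb
  class if it has the form \<open>u(p) = k(p, z0)\<close> for an \<^emph>\<open>action\<close> \<open>k\<close>, a map \<open>k(p, z)\<close> for which \<open>k(p, _)\<close>
  is the identity of \<open>Z\<close> at every \<open>p\<close> of the collapsed subspace (\<open>gottliebI\<close>).  Given an action \<open>k\<close> and a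
  loop \<open>g\<close>, the square \<open>k((w, s), g(w, t))\<close> has the two products of \<open>k(_, z0)\<close> and \<open>g\<close> as the two halves
  of its boundary, whence Gottlieb groups are commutative (\<open>gottlieb_commute\<close>).

  Gottlieb groups are not functorial in \<open>Z\<close>, but actions can be moved between \<open>Y\<close> and the mapping
  space \<open>M\<close>.  An action of \<open>(A \<times> X) \<times> I\<close> on \<open>Y\<close> induces the action \<open>((a, t), m) \<mapsto> (x \<mapsto> k(((a, x), t), m x))\<close>
  of \<open>A \<times> I\<close> on \<open>M\<close> (\<open>gottlieb_adj\<close>); this gives both the injection \<open>adj_class\<close>, which is currying, and
  the section.  Conversely an action \<open>G\<close> on \<open>M\<close> is applied to constant maps: \<open>G(a, t)(C\<^sub>y)(x)\<close> is an
  action of \<open>(A \<times> X) \<times> I\<close> on \<open>Y\<close> (\<open>gottlieb_action\<close>), and its value at \<open>x = x0\<close> shows that evaluation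
  preserves Gottlieb classes.

  Exactness at the first two places is a question about the subspace \<open>A \<times> {x0}\<close>.  Uncurrying a loop of
  \<open>M\<close>, or a homotopy of such loops, produces a map on \<open>(A \<times> X) \<times> I\<close> that need not be constant there.  It is
  corrected in \<open>reduce_along_basepoint\<close>: multiply \<open>u\<close> by the inverse of its restriction to \<open>x0\<close>.  At \<open>x0\<close>
  the product is a loop followed by its inverse, hence contractible in a canonical way, and the
  homotopy extension property of \<open>x0\<close> in \<open>X\<close> extends the contraction to all of \<open>X\<close>.  The construction
  is carried out with a space \<open>V\<close> of parameters.  With \<open>V = I\<close> it turns a homotopy of curried loops
  into one of the loops themselves (\<open>adj_injective\<close>).  With \<open>V = Y\<close> it turns \<open>G(a, t)(C\<^sub>y)(x)\<close> into an
  action that is trivial over \<open>A \<times> {x0}\<close> too; if the class of \<open>G\<close> evaluates to zero, multiplying by the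
  inverse of the restriction does not change this class, so it comes from \<open>\<Sigma>(A \<and> X)\<close> (\<open>gottlieb_kernel\<close>).
\<close>

section \<open>Continuity and the compact-open topology\<close>

abbreviation unit_interval :: "real topology" ("\<I>")
  where "\<I> \<equiv> top_of_set {0..1}"

lemma continuous_map_unit_interval:
  "continuous_map P \<I> f \<longleftrightarrow> continuous_map P euclideanreal f \<and> (\<forall>p\<in>topspace P. 0 \<le> f p \<and> f p \<le> 1)"
  by (auto simp: continuous_map_in_subtopology)

lemma continuous_map_compose':
  assumes "continuous_map P Q f" and "continuous_map Q Z g" 
  shows "continuous_map P Z (\<lambda>p. g (f p))"
  using continuous_map_compose[OF assms] by (simp add: o_def)

lemma continuous_map_fst':
  "continuous_map P (prod_topology Q R) f \<Longrightarrow> continuous_map P Q (\<lambda>p. fst (f p))"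
  and continuous_map_snd':
  "continuous_map P (prod_topology Q R) f \<Longrightarrow> continuous_map P R (\<lambda>p. snd (f p))"
  by (simp_all add: continuous_map_pairwise o_def)

lemma locally_compact_space_unit_interval: "locally_compact_space \<I>"
  by (intro compact_imp_locally_compact_space compact_space_subtopology) simp

lemma Hausdorff_space_unit_interval: "Hausdorff_space \<I>"
  by (simp add: Hausdorff_space_subtopology)

lemma openin_compact_open_basic:
  "compactin X K \<Longrightarrow> openin Y U \<Longrightarrow> openin (compact_open X Y) {f \<in> cmaps X Y. f ` K \<subseteq> U}"
  unfolding compact_open_def by (rule topology_generated_by_Basis) blast

lemma continuous_map_into_compact_open:
  assumes "\<And>w. w \<in> topspace W \<Longrightarrow> F w \<in> cmaps X Y"
    and "\<And>K U. compactin X K \<Longrightarrow> openin Y U \<Longrightarrow> openin W {w \<in> topspace W. F w ` K \<subseteq> U}"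
  shows "continuous_map W (compact_open X Y) F"
  unfolding compact_open_def
proof (rule continuous_on_generated_topo)
  fix V assume "V \<in> {{f \<in> cmaps X Y. f ` K \<subseteq> U} |K U. compactin X K \<and> openin Y U}"
  then obtain K U where V: "V = {f \<in> cmaps X Y. f ` K \<subseteq> U}" "compactin X K" "openin Y U"
    by blast
  have "F -` V \<inter> topspace W = {w \<in> topspace W. F w ` K \<subseteq> U}"
    using assms(1) V(1) by auto
  then show "openin W (F -` V \<inter> topspace W)"
    using assms(2) V(2,3) by simp
next
  have "cmaps X Y \<subseteq> \<Union> {{f \<in> cmaps X Y. f ` K \<subseteq> U} |K U. compactin X K \<and> openin Y U}"
    using topspace_compact_open[of X Y] unfolding compact_open_def topology_generated_by_topspace
    by simp
  then show "F ` topspace W \<subseteq> \<Union> {{f \<in> cmaps X Y. f ` K \<subseteq> U} |K U. compactin X K \<and> openin Y U}"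
    using assms(1) by blast
qed

lemma continuous_map_curry:
  assumes g: "continuous_map (prod_topology W X) Y g"
  shows "continuous_map W (compact_open X Y) (\<lambda>w. \<lambda>x\<in>topspace X. g (w, x))"
proof (rule continuous_map_into_compact_open)
  fix w assume w: "w \<in> topspace W"
  have "continuous_map X Y (\<lambda>x. g (w, x))"
    by (rule continuous_map_compose'[OF _ g]) (simp add: continuous_map_paired w)
  then have "continuous_map X Y (\<lambda>x\<in>topspace X. g (w, x))"
    by (rule continuous_map_eq) simp
  then show "(\<lambda>x\<in>topspace X. g (w, x)) \<in> cmaps X Y"
    by (simp add: cmaps_def)
next
  fix K U assume K: "compactin X K" and U: "openin Y U"
  let ?S = "{w \<in> topspace W. (\<lambda>x\<in>topspace X. g (w, x)) ` K \<subseteq> U}"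
  let ?O = "{p \<in> topspace (prod_topology W X). g p \<in> U}"
  have KX: "K \<subseteq> topspace X" using K compactin_subset_topspace by blast
  have O: "openin (prod_topology W X) ?O"
    using g U by (rule openin_continuous_map_preimage)
  have "\<exists>T. openin W T \<and> w \<in> T \<and> T \<subseteq> ?S" if w: "w \<in> ?S" for w
  proof -
    have "compactin W {w}" "{w} \<times> K \<subseteq> ?O" using w KX by auto
    then obtain T V where "openin W T" "openin X V" "{w} \<subseteq> T" "K \<subseteq> V" "T \<times> V \<subseteq> ?O"
      by (rule Wallace_theorem_prod_topology[OF _ K O])
    then have "openin W T" "w \<in> T" "T \<subseteq> topspace W" "\<And>v x. v \<in> T \<Longrightarrow> x \<in> K \<Longrightarrow> g (v, x) \<in> U"
      using openin_subset[of W T] by blast+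
    then have "openin W T \<and> w \<in> T \<and> T \<subseteq> ?S"
      using KX by (auto simp: subset_iff)
    then show ?thesis by blast
  qed
  then show "openin W ?S"
    by (subst openin_subopen) blast
qed

lemma continuous_map_uncurry:
  assumes F: "continuous_map W (compact_open X Y) F"
    and "locally_compact_space X" "Hausdorff_space X"
  shows "continuous_map (prod_topology W X) Y (\<lambda>p. F (fst p) (snd p))"
proof -
  have nb: "neighbourhood_base_of (compactin X) X"
    using assms locally_compact_space_neighbourhood_base by blast
  have Fc: "F w \<in> cmaps X Y" if "w \<in> topspace W" for w
    using continuous_map_image_subset_topspace[OF F] that topspace_compact_open by blast
  have Fx: "F w x \<in> topspace Y" if "w \<in> topspace W" "x \<in> topspace X" for w x
    using Fc[OF that(1)] that(2) unfolding cmaps_def continuous_map_def by auto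
  have "openin (prod_topology W X) {p \<in> topspace (prod_topology W X). F (fst p) (snd p) \<in> U}"
    (is "openin _ ?S") if U: "openin Y U" for U
  proof -
    have "\<exists>T. openin (prod_topology W X) T \<and> p \<in> T \<and> T \<subseteq> ?S" if p: "p \<in> ?S" for p
    proof -
      obtain w x where wx: "p = (w, x)" "w \<in> topspace W" "x \<in> topspace X" "F w x \<in> U"
        using p by auto
      have "openin X {x \<in> topspace X. F w x \<in> U}"
        using Fc[OF wx(2)] U openin_continuous_map_preimage unfolding cmaps_def by blast
      then obtain V K where VK: "openin X V" "compactin X K" "x \<in> V" "V \<subseteq> K"
          "K \<subseteq> {x \<in> topspace X. F w x \<in> U}"
        using nb wx unfolding neighbourhood_base_of by (smt (verit) mem_Collect_eq)
      have "openin W {w \<in> topspace W. F w \<in> {f \<in> cmaps X Y. f ` K \<subseteq> U}}"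
        using F openin_compact_open_basic[OF VK(2) U] openin_continuous_map_preimage by blast
      then have "openin (prod_topology W X)
          ({w \<in> topspace W. F w \<in> {f \<in> cmaps X Y. f ` K \<subseteq> U}} \<times> V)"
        using VK(1) by (simp add: openin_prod_Times_iff)
      moreover have "p \<in> {w \<in> topspace W. F w \<in> {f \<in> cmaps X Y. f ` K \<subseteq> U}} \<times> V"
        using VK wx Fc by auto
      moreover have "{w \<in> topspace W. F w \<in> {f \<in> cmaps X Y. f ` K \<subseteq> U}} \<times> V \<subseteq> ?S"
        using VK(4) openin_subset[OF VK(1)] by fastforce
      ultimately show ?thesis by blast
    qed
    then show ?thesis by (subst openin_subopen) blast
  qed
  then show ?thesis
    unfolding continuous_map_def using Fx by auto
qed

lemma continuous_map_precompose:
  assumes \<phi>: "continuous_map V X \<phi>"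
  shows "continuous_map (compact_open X Y) (compact_open V Y) (\<lambda>f. \<lambda>v\<in>topspace V. f (\<phi> v))"
proof (rule continuous_map_into_compact_open)
  fix f assume "f \<in> topspace (compact_open X Y)"
  then have "continuous_map X Y f" by (simp add: topspace_compact_open cmaps_def)
  then have "continuous_map V Y (\<lambda>v\<in>topspace V. f (\<phi> v))"
    by (intro continuous_map_eq[OF continuous_map_compose'[OF \<phi>]]) auto
  then show "(\<lambda>v\<in>topspace V. f (\<phi> v)) \<in> cmaps V Y" by (simp add: cmaps_def)
next
  fix K U assume K: "compactin V K" and U: "openin Y U"
  have "{f \<in> topspace (compact_open X Y). (\<lambda>v\<in>topspace V. f (\<phi> v)) ` K \<subseteq> U} =
        {f \<in> cmaps X Y. f ` (\<phi> ` K) \<subseteq> U}"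
    using compactin_subset_topspace[OF K] by (auto simp: topspace_compact_open subset_iff)
  then show "openin (compact_open X Y)
      {f \<in> topspace (compact_open X Y). (\<lambda>v\<in>topspace V. f (\<phi> v)) ` K \<subseteq> U}"
    using openin_compact_open_basic[OF image_compactin[OF K \<phi>] U] by simp
qed

text \<open>
  Evaluation \<open>(f, x) \<mapsto> f x\<close> can fail to be continuous if \<open>X\<close> is not locally compact.  Restricting along
  \<open>\<phi>\<close> replaces \<open>X\<close> by the locally compact \<open>V\<close>, where evaluation is continuous.  The mapping space need not be
  locally compact, so its self-maps are only ever evaluated along loops and along constant maps.
\<close>

lemma continuous_map_eval_along:
  assumes F: "continuous_map W (compact_open X Y) F" and \<phi>: "continuous_map V X \<phi>"
    and V: "locally_compact_space V" "Hausdorff_space V"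
  shows "continuous_map (prod_topology W V) Y (\<lambda>p. F (fst p) (\<phi> (snd p)))"
proof -
  have "continuous_map W (compact_open V Y) (\<lambda>w. \<lambda>v\<in>topspace V. F w (\<phi> v))"
    using continuous_map_compose'[OF F continuous_map_precompose[OF \<phi>]] .
  from continuous_map_uncurry[OF this V] show ?thesis
    by (rule continuous_map_eq) auto
qed

lemma continuous_map_eval_point:
  assumes "x \<in> topspace X"
  shows "continuous_map (compact_open X Y) Y (\<lambda>f. f x)"
proof -
  have "openin (compact_open X Y) {f \<in> topspace (compact_open X Y). f x \<in> U}"
    if "openin Y U" for U
    using openin_compact_open_basic[of X "{x}" Y U] that assms
    by (simp add: topspace_compact_open)
  then show ?thesis
    using assms unfolding continuous_map_def 
    by (auto simp: topspace_compact_open cmaps_def continuous_map_def)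
qed

lemmas cont_intros = continuous_map_pairedI continuous_map_fst' continuous_map_snd'
  continuous_map_fst continuous_map_snd continuous_map_id[unfolded id_def]

text \<open>
  A family that starts in a path component stays in it.  This is how maps into the full space of maps
  are seen to land in the components that define \<open>map_null\<close> and \<open>aut1\<close>.
\<close>

lemma path_component_slide:
  assumes h: "continuous_map (prod_topology P \<I>) T h" and p: "p \<in> topspace P"
    and c: "path_component_of T c (h (p, 0))" and t: "t \<in> {0..1}"
  shows "path_component_of T c (h (p, t))"
proof -
  have "continuous_map \<I> \<I> (\<lambda>s. s * t)"
    using t by (auto simp: continuous_map_unit_interval mult_le_one intro!: continuous_intros)
  then have "continuous_map \<I> T (\<lambda>s. h (p, s * t))"
    using p by (intro continuous_map_compose'[OF _ h] continuous_map_pairedI) auto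
  then have "path_component_of T (h (p, 0)) (h (p, t))"
    unfolding path_component_of_def pathin_def by (intro exI[of _ "\<lambda>s. h (p, s * t)"]) simp
  with c show ?thesis
    by (rule path_component_of_trans)
qed

section \<open>Loops and homotopies of loops\<close>

text \<open>
  The part of \<open>W \<times> I\<close> that goes to the base point.  For \<open>S = {a0}\<close> this is \<open>susp_base\<close>; an arbitrary
  \<open>S\<close> allows \<open>W\<close> to be a product in place of the smash product, with \<open>S\<close> the collapsed part.
\<close>

definition loop_base :: "'w topology \<Rightarrow> 'w set \<Rightarrow> ('w \<times> real) set" where
  "loop_base W S = topspace W \<times> {0, 1} \<union> S \<times> {0..1}"

definition loops :: "'w topology \<Rightarrow> 'w set \<Rightarrow> 'z topology \<Rightarrow> 'z \<Rightarrow> ('w \<times> real \<Rightarrow> 'z) set" where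
  "loops W S Z z0 =
     {u. continuous_map (prod_topology W \<I>) Z u \<and> (\<forall>p\<in>loop_base W S. u p = z0)}"

definition loop_homotopic ::
    "'w topology \<Rightarrow> 'w set \<Rightarrow> 'z topology \<Rightarrow> 'z \<Rightarrow> ('w \<times> real \<Rightarrow> 'z) \<Rightarrow> ('w \<times> real \<Rightarrow> 'z) \<Rightarrow> bool"
  where "loop_homotopic W S Z z0 =
     homotopic_with (\<lambda>h. \<forall>p\<in>loop_base W S. h p = z0) (prod_topology W \<I>) Z"

definition loop_cat :: "('w \<times> real \<Rightarrow> 'z) \<Rightarrow> ('w \<times> real \<Rightarrow> 'z) \<Rightarrow> 'w \<times> real \<Rightarrow> 'z" where
  "loop_cat u v = (\<lambda>(w, t). if t \<le> 1/2 then u (w, 2 * t) else v (w, 2 * t - 1))"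

definition loop_rev :: "('w \<times> real \<Rightarrow> 'z) \<Rightarrow> 'w \<times> real \<Rightarrow> 'z" where
  "loop_rev u = (\<lambda>(w, t). u (w, 1 - t))"

lemma loops_continuous: "u \<in> loops W S Z z0 \<Longrightarrow> continuous_map (prod_topology W \<I>) Z u"
  and loops_at_base: "u \<in> loops W S Z z0 \<Longrightarrow> p \<in> loop_base W S \<Longrightarrow> u p = z0"
  and loops_at_0: "u \<in> loops W S Z z0 \<Longrightarrow> w \<in> topspace W \<Longrightarrow> u (w, 0) = z0"
  and loops_at_1: "u \<in> loops W S Z z0 \<Longrightarrow> w \<in> topspace W \<Longrightarrow> u (w, 1) = z0"
  and loops_at_S: "u \<in> loops W S Z z0 \<Longrightarrow> w \<in> S \<Longrightarrow> 0 \<le> t \<Longrightarrow> t \<le> 1 \<Longrightarrow> u (w, t) = z0"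
  by (auto simp: loops_def loop_base_def)

lemma loops_const: "z0 \<in> topspace Z \<Longrightarrow> (\<lambda>_. z0) \<in> loops W S Z z0"
  by (simp add: loops_def)

lemma loops_compose:
  "u \<in> loops W S Z z0 \<Longrightarrow> continuous_map Z Z' \<phi> \<Longrightarrow> \<phi> z0 = z0' \<Longrightarrow> (\<lambda>p. \<phi> (u p)) \<in> loops W S Z' z0'"
  by (auto simp: loops_def intro: continuous_map_compose')

lemma loop_homotopicI:
  assumes S: "S \<subseteq> topspace W"
    and H: "continuous_map (prod_topology (prod_topology W \<I>) \<I>) Z H"
    and base: "\<And>p s. p \<in> loop_base W S \<Longrightarrow> 0 \<le> s \<Longrightarrow> s \<le> 1 \<Longrightarrow> H (p, s) = z0"
    and ends: "\<And>w t. w \<in> topspace W \<Longrightarrow> 0 \<le> t \<Longrightarrow> t \<le> 1 \<Longrightarrow> H ((w, t), 0) = u (w, t)"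
      "\<And>w t. w \<in> topspace W \<Longrightarrow> 0 \<le> t \<Longrightarrow> t \<le> 1 \<Longrightarrow> H ((w, t), 1) = v (w, t)"
  shows "loop_homotopic W S Z z0 u v"
proof -
  have b: "p \<in> topspace (prod_topology W \<I>)" if "p \<in> loop_base W S" for p
    using that S by (auto simp: loop_base_def)
  have c: "continuous_map (prod_topology \<I> (prod_topology W \<I>)) Z (\<lambda>p. H (snd p, fst p))"
    by (rule continuous_map_compose'[OF _ H]) (rule cont_intros)+
  show ?thesis
    unfolding loop_homotopic_def
    by (subst homotopic_with)
      (use b c base ends in \<open>auto intro!: exI[of _ "\<lambda>p. H (snd p, fst p)"]\<close>)
qed

lemma loop_homotopicE:
  assumes "loop_homotopic W S Z z0 u v"
  obtains H where "continuous_map (prod_topology (prod_topology W \<I>) \<I>) Z H"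
    "\<And>p s. p \<in> loop_base W S \<Longrightarrow> 0 \<le> s \<Longrightarrow> s \<le> 1 \<Longrightarrow> H (p, s) = z0"
    "\<And>p. H (p, 0) = u p" "\<And>p. H (p, 1) = v p"
proof -
  obtain h where h: "continuous_map (prod_topology \<I> (prod_topology W \<I>)) Z h"
      "\<And>p. h (0, p) = u p" "\<And>p. h (1, p) = v p"
      "\<And>s p. s \<in> {0..1} \<Longrightarrow> p \<in> loop_base W S \<Longrightarrow> h (s, p) = z0"
    using assms unfolding loop_homotopic_def homotopic_with_def by blast
  have "continuous_map (prod_topology (prod_topology W \<I>) \<I>) Z (\<lambda>p. h (snd p, fst p))"
    by (rule continuous_map_compose'[OF _ h(1)]) (rule cont_intros)+
  from that[OF this] show ?thesis using h by auto
qed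

lemma loop_homotopic_refl: "u \<in> loops W S Z z0 \<Longrightarrow> loop_homotopic W S Z z0 u u"
  by (simp add: loop_homotopic_def loops_def)

lemma loop_homotopic_sym: "loop_homotopic W S Z z0 u v \<Longrightarrow> loop_homotopic W S Z z0 v u"
  unfolding loop_homotopic_def by (rule homotopic_with_symD)

lemma loop_homotopic_trans:
  "loop_homotopic W S Z z0 u v \<Longrightarrow> loop_homotopic W S Z z0 v x \<Longrightarrow> loop_homotopic W S Z z0 u x"
  unfolding loop_homotopic_def by (rule homotopic_with_trans)

lemma loop_homotopic_loops:
  assumes "loop_homotopic W S Z z0 u v"
  shows "u \<in> loops W S Z z0" "v \<in> loops W S Z z0"
  using homotopic_with_imp_continuous_maps[OF assms[unfolded loop_homotopic_def]]
    homotopic_with_imp_property[OF assms[unfolded loop_homotopic_def]]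
  by (auto simp: loops_def)

lemma loop_homotopic_compose:
  assumes "loop_homotopic W S Z z0 u v" "continuous_map Z Z' \<phi>" "\<phi> z0 = z0'"
  shows "loop_homotopic W S Z' z0' (\<lambda>p. \<phi> (u p)) (\<lambda>p. \<phi> (v p))"
  using homotopic_with_compose_continuous_map_left[OF assms(1)[unfolded loop_homotopic_def] assms(2)]
    assms(3) unfolding loop_homotopic_def by (simp add: o_def)

lemma loop_homotopic_mono:
  assumes "loop_homotopic W S Z z0 u v" "S' \<subseteq> S"
  shows "loop_homotopic W S' Z z0 u v"
  using homotopic_with_mono[OF assms(1)[unfolded loop_homotopic_def], of "\<lambda>h. \<forall>p\<in>loop_base W S'. h p = z0"]
    assms(2) unfolding loop_homotopic_def loop_base_def by blast

lemma continuous_map_loop_cat: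
  assumes u: "continuous_map (prod_topology W \<I>) Z u" and v: "continuous_map (prod_topology W \<I>) Z v"
    and match: "\<And>w. w \<in> topspace W \<Longrightarrow> u (w, 1) = v (w, 0)"
  shows "continuous_map (prod_topology W \<I>) Z (loop_cat u v)"
proof -
  let ?P = "prod_topology W \<I>"
  have r: "continuous_map ?P euclideanreal snd"
    using continuous_map_snd[of W \<I>] by (simp add: continuous_map_in_subtopology)
  have 1: "continuous_map ?P Z (\<lambda>p. u (fst p, min 1 (2 * snd p)))"
    by (rule continuous_map_compose'[OF _ u], rule continuous_map_pairedI, rule continuous_map_fst)
      (use r in \<open>auto simp: continuous_map_unit_interval intro!: continuous_intros\<close>)
  have 2: "continuous_map ?P Z (\<lambda>p. v (fst p, max 0 (2 * snd p - 1)))"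
    by (rule continuous_map_compose'[OF _ v], rule continuous_map_pairedI, rule continuous_map_fst)
      (use r in \<open>auto simp: continuous_map_unit_interval intro!: continuous_intros\<close>)
  have "continuous_map ?P Z (\<lambda>p. if snd p \<le> 1/2 then u (fst p, min 1 (2 * snd p))
      else v (fst p, max 0 (2 * snd p - 1)))"
    by (rule continuous_map_cases_le[OF r _ continuous_map_from_subtopology[OF 1]
          continuous_map_from_subtopology[OF 2]]) (use match in auto)
  then show ?thesis
    by (rule continuous_map_eq) (auto simp: loop_cat_def)
qed

lemma loops_cat:
  assumes "u \<in> loops W S Z z0" "v \<in> loops W S Z z0"
  shows "loop_cat u v \<in> loops W S Z z0"
proof -
  have "continuous_map (prod_topology W \<I>) Z (loop_cat u v)"
    by (rule continuous_map_loop_cat) (use assms in \<open>auto simp: loops_def loop_base_def\<close>)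
  then show ?thesis
    using assms by (auto simp: loops_def loop_base_def loop_cat_def)
qed

lemma continuous_map_loop_rev:
  assumes u: "continuous_map (prod_topology W \<I>) Z u"
  shows "continuous_map (prod_topology W \<I>) Z (loop_rev u)"
proof -
  have r: "continuous_map (prod_topology W \<I>) euclideanreal snd"
    using continuous_map_snd[of W \<I>] by (simp add: continuous_map_in_subtopology)
  show ?thesis
    unfolding loop_rev_def case_prod_beta
    by (rule continuous_map_compose'[OF _ u], rule continuous_map_pairedI, rule continuous_map_fst)
      (use r in \<open>auto simp: continuous_map_unit_interval intro!: continuous_intros\<close>)
qed

lemma loops_rev: "u \<in> loops W S Z z0 \<Longrightarrow> loop_rev u \<in> loops W S Z z0"
  using continuous_map_loop_rev[of W Z u] by (auto simp: loops_def loop_base_def loop_rev_def)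

lemma loop_rev_const: "loop_rev (\<lambda>_. z) = (\<lambda>_. z)"
  by (auto simp: loop_rev_def)

lemma loop_homotopic_rev:
  assumes S: "S \<subseteq> topspace W" and uv: "loop_homotopic W S Z z0 u v"
  shows "loop_homotopic W S Z z0 (loop_rev u) (loop_rev v)"
proof -
  let ?r = "\<lambda>p. (fst p, 1 - snd p)"
  have s: "continuous_map (prod_topology W \<I>) euclideanreal snd"
    using continuous_map_snd[of W \<I>] by (simp add: continuous_map_in_subtopology)
  have r: "continuous_map (prod_topology W \<I>) (prod_topology W \<I>) ?r"
    by (rule continuous_map_pairedI, rule continuous_map_fst)
      (use s in \<open>auto simp: continuous_map_unit_interval intro!: continuous_intros\<close>)
  have "?r p \<in> loop_base W S" if "p \<in> loop_base W S" for p
    using that by (auto simp: loop_base_def)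
  then show ?thesis
    using homotopic_with_compose_continuous_map_right[OF uv[unfolded loop_homotopic_def] r,
        of "\<lambda>h. \<forall>p\<in>loop_base W S. h p = z0"]
    unfolding loop_homotopic_def loop_rev_def o_def case_prod_beta by simp
qed

lemma loop_homotopic_cat:
  assumes S: "S \<subseteq> topspace W"
    and "loop_homotopic W S Z z0 u u'" "loop_homotopic W S Z z0 v v'"
  shows "loop_homotopic W S Z z0 (loop_cat u v) (loop_cat u' v')"
proof -
  obtain H where H: "continuous_map (prod_topology (prod_topology W \<I>) \<I>) Z H"
    "\<And>p s. p \<in> loop_base W S \<Longrightarrow> 0 \<le> s \<Longrightarrow> s \<le> 1 \<Longrightarrow> H (p, s) = z0"
    "\<And>p. H (p, 0) = u p" "\<And>p. H (p, 1) = u' p"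
    using loop_homotopicE[OF assms(2)] by blast
  obtain K where K: "continuous_map (prod_topology (prod_topology W \<I>) \<I>) Z K"
    "\<And>p s. p \<in> loop_base W S \<Longrightarrow> 0 \<le> s \<Longrightarrow> s \<le> 1 \<Longrightarrow> K (p, s) = z0"
    "\<And>p. K (p, 0) = v p" "\<And>p. K (p, 1) = v' p"
    using loop_homotopicE[OF assms(3)] by blast
  let ?flip = "\<lambda>L p. L ((fst (fst p), snd p), snd (fst p))"
  let ?c = "loop_cat (?flip H) (?flip K)"
  have flip: "continuous_map (prod_topology (prod_topology W \<I>) \<I>) Z (?flip L)"
    if "continuous_map (prod_topology (prod_topology W \<I>) \<I>) Z L" for L
    by (rule continuous_map_compose'[OF _ that]) (rule cont_intros)+
  have "continuous_map (prod_topology (prod_topology W \<I>) \<I>) Z ?c"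
    by (rule continuous_map_loop_cat[OF flip[OF H(1)] flip[OF K(1)]])
      (use H(2) K(2) in \<open>auto simp: loop_base_def\<close>)
  then have c: "continuous_map (prod_topology (prod_topology W \<I>) \<I>) Z (?flip ?c)"
    by (rule flip)
  show ?thesis
    by (rule loop_homotopicI[OF S c])
      (use H K in \<open>auto simp: loop_cat_def loop_base_def\<close>)
qed

text \<open>
  A square is convex, so any two paths in it with common end points are joined by the straight-line
  homotopy.  The group axioms and the commutativity of Gottlieb groups are instances, each for a suitable
  map \<open>Q\<close> on a family of squares.
\<close>

lemma loop_homotopic_paths:
  assumes S: "S \<subseteq> topspace W"
    and Q: "continuous_map (prod_topology W (prod_topology \<I> \<I>)) Z Q"
    and base: "\<And>w s t. w \<in> S \<Longrightarrow> 0 \<le> s \<Longrightarrow> s \<le> 1 \<Longrightarrow> 0 \<le> t \<Longrightarrow> t \<le> 1 \<Longrightarrow> Q (w, s, t) = z0"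
    and cont: "continuous_on {0..1} f" "continuous_on {0..1} g"
      "continuous_on {0..1} f'" "continuous_on {0..1} g'"
    and range: "\<And>t. 0 \<le> t \<Longrightarrow> t \<le> 1 \<Longrightarrow>
      0 \<le> f t \<and> f t \<le> 1 \<and> 0 \<le> g t \<and> g t \<le> 1 \<and> 0 \<le> f' t \<and> f' t \<le> 1 \<and> 0 \<le> g' t \<and> g' t \<le> (1::real)"
    and start: "f' 0 = f 0" "g' 0 = g 0" "\<And>w. w \<in> topspace W \<Longrightarrow> Q (w, f 0, g 0) = z0"
    and finish: "f' 1 = f 1" "g' 1 = g 1" "\<And>w. w \<in> topspace W \<Longrightarrow> Q (w, f 1, g 1) = z0"
    and u: "\<And>w t. w \<in> topspace W \<Longrightarrow> 0 \<le> t \<Longrightarrow> t \<le> 1 \<Longrightarrow> u (w, t) = Q (w, f t, g t)"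
    and v: "\<And>w t. w \<in> topspace W \<Longrightarrow> 0 \<le> t \<Longrightarrow> t \<le> 1 \<Longrightarrow> v (w, t) = Q (w, f' t, g' t)"
  shows "loop_homotopic W S Z z0 u v"
proof -
  let ?P = "prod_topology (prod_topology W \<I>) \<I>"
  let ?mix = "\<lambda>a b p. (1 - snd p) * a (snd (fst p)) + snd p * b (snd (fst p)) :: real"
  have r: "continuous_map ?P euclideanreal snd"
    using continuous_map_snd[of "prod_topology W \<I>" \<I>] by (simp add: continuous_map_in_subtopology)
  have t: "continuous_map ?P \<I> (\<lambda>p. snd (fst p))" by (rule cont_intros)+
  have mix: "continuous_map ?P \<I> (?mix a b)"
    if "continuous_on {0..1} a" "continuous_on {0..1} b"
      and ab01: "\<And>t. 0 \<le> t \<Longrightarrow> t \<le> 1 \<Longrightarrow> 0 \<le> a t \<and> a t \<le> 1 \<and> 0 \<le> b t \<and> b t \<le> 1" for a b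
  proof -
    have ab: "continuous_map \<I> euclideanreal a" "continuous_map \<I> euclideanreal b"
      using that by simp_all
    have c: "continuous_map ?P euclideanreal (?mix a b)"
      by (intro continuous_intros r continuous_map_compose'[OF t ab(1)] continuous_map_compose'[OF t ab(2)])
        simp
    have "0 \<le> ?mix a b p \<and> ?mix a b p \<le> 1" if "p \<in> topspace ?P" for p
    proof -
      have p: "0 \<le> snd p" "snd p \<le> 1" "0 \<le> snd (fst p)" "snd (fst p) \<le> 1" using that by auto
      from ab01[OF p(3,4)] p(1,2) show ?thesis
        by (intro conjI add_nonneg_nonneg mult_nonneg_nonneg convex_bound_le) auto
    qed
    with c show ?thesis by (auto simp: continuous_map_unit_interval)
  qed
  have c: "continuous_map ?P Z (\<lambda>p. Q (fst (fst p), ?mix f f' p, ?mix g g' p))"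
    by (rule continuous_map_compose'[OF _ Q], intro continuous_map_pairedI mix)
      ((rule cont_intros)+, use cont range in auto)
  have W: "w \<in> topspace W" if "w \<in> S" for w using that S by auto
  show ?thesis
  proof (rule loop_homotopicI[OF S c])
    fix p s assume p: "p \<in> loop_base W S" and s: "(0::real) \<le> s" "s \<le> 1"
    show "Q (fst (fst (p, s)), ?mix f f' (p, s), ?mix g g' (p, s)) = z0"
    proof (cases "fst p \<in> S")
      case True
      then have t: "0 \<le> snd p" "snd p \<le> 1" using p by (auto simp: loop_base_def)
      have "(p, s) \<in> topspace ?P" using p S s by (auto simp: loop_base_def)
      then have "?mix f f' (p, s) \<in> {0..1}" "?mix g g' (p, s) \<in> {0..1}"
        using continuous_map_image_subset_topspace[OF mix[OF cont(1,3)]] 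
          continuous_map_image_subset_topspace[OF mix[OF cont(2,4)]] range by (force simp: image_subset_iff)+
      then show ?thesis using base[OF True] by simp
    next
      case False
      then have "fst p \<in> topspace W" "snd p = 0 \<or> snd p = 1" using p by (auto simp: loop_base_def)
      then show ?thesis using start finish by (auto simp: algebra_simps)
    qed
  qed (use u v in auto)
qed

lemma loop_homotopic_reparam:
  assumes S: "S \<subseteq> topspace W" and u: "u \<in> loops W S Z z0"
    and "continuous_on {0..1} f" "continuous_on {0..1} g"
    and "\<And>t. 0 \<le> t \<Longrightarrow> t \<le> 1 \<Longrightarrow> 0 \<le> f t \<and> f t \<le> 1 \<and> 0 \<le> g t \<and> g t \<le> 1"
    and "g 0 = f 0" "f 0 \<in> {0, 1}" "g 1 = f 1" "f 1 \<in> {0, 1}"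
    and x: "\<And>w t. w \<in> topspace W \<Longrightarrow> 0 \<le> t \<Longrightarrow> t \<le> 1 \<Longrightarrow> x (w, t) = u (w, f t)"
    and y: "\<And>w t. w \<in> topspace W \<Longrightarrow> 0 \<le> t \<Longrightarrow> t \<le> 1 \<Longrightarrow> y (w, t) = u (w, g t)"
  shows "loop_homotopic W S Z z0 x y"
proof (rule loop_homotopic_paths[OF S, where Q = "\<lambda>p. u (fst p, fst (snd p))" and f = f and f' = g
      and g = "\<lambda>_. 0" and g' = "\<lambda>_. 0"])
  show "continuous_map (prod_topology W (prod_topology \<I> \<I>)) Z (\<lambda>p. u (fst p, fst (snd p)))"
    by (rule continuous_map_compose'[OF _ loops_continuous[OF u]]) (rule cont_intros)+
qed (use assms in \<open>auto simp: loops_def loop_base_def\<close>)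

lemma loop_cat_assoc:
  assumes S: "S \<subseteq> topspace W"
    and "u \<in> loops W S Z z0" "v \<in> loops W S Z z0" "x \<in> loops W S Z z0"
  shows "loop_homotopic W S Z z0 (loop_cat (loop_cat u v) x) (loop_cat u (loop_cat v x))"
  \<comment> \<open>Reading \<open>(u v) x\<close> at speed \<open>1/2\<close>, \<open>1\<close>, \<open>2\<close> on \<open>[0, 1/2]\<close>, \<open>[1/2, 3/4]\<close>, \<open>[3/4, 1]\<close> gives \<open>u (v x)\<close>;
      this time change is convex, hence the maximum of its three linear pieces.\<close>
proof (rule loop_homotopic_reparam[OF S, where u = "loop_cat (loop_cat u v) x" and f = "\<lambda>t. t"
      and g = "\<lambda>t. max (t / 2) (max (t - 1/4) (2 * t - 1))"])
  show "loop_cat (loop_cat u v) x \<in> loops W S Z z0" using assms by (intro loops_cat)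
  fix w and t :: real assume "w \<in> topspace W" "0 \<le> t" "t \<le> 1"
  consider "t \<le> 1/2" | "1/2 < t" "t \<le> 3/4" | "3/4 < t" by linarith
  then show "loop_cat u (loop_cat v x) (w, t)
      = loop_cat (loop_cat u v) x (w, max (t / 2) (max (t - 1/4) (2 * t - 1)))"
  proof cases
    case 1
    then have "max (t / 2) (max (t - 1/4) (2 * t - 1)) = t / 2" by (simp add: max_def)
    with 1 show ?thesis by (simp add: loop_cat_def)
  next
    case 2
    then have "max (t / 2) (max (t - 1/4) (2 * t - 1)) = t - 1/4" by (simp add: max_def)
    with 2 show ?thesis by (simp add: loop_cat_def algebra_simps)
  next
    case 3
    then have "max (t / 2) (max (t - 1/4) (2 * t - 1)) = 2 * t - 1" by (simp add: max_def)
    with 3 show ?thesis by (simp add: loop_cat_def algebra_simps)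
  qed
qed (auto simp: le_max_iff_disj intro!: continuous_intros)

lemma loop_cat_const_left:
  assumes S: "S \<subseteq> topspace W" and u: "u \<in> loops W S Z z0"
  shows "loop_homotopic W S Z z0 (loop_cat (\<lambda>_. z0) u) u"
  by (rule loop_homotopic_reparam[OF S u, where f = "\<lambda>t. max 0 (2 * t - 1)" and g = "\<lambda>t. t"])
    (use loops_at_0[OF u] in \<open>auto simp: loop_cat_def intro!: continuous_intros\<close>)

lemma loop_cat_const_right:
  assumes S: "S \<subseteq> topspace W" and u: "u \<in> loops W S Z z0"
  shows "loop_homotopic W S Z z0 (loop_cat u (\<lambda>_. z0)) u"
  by (rule loop_homotopic_reparam[OF S u, where f = "\<lambda>t. min 1 (2 * t)" and g = "\<lambda>t. t"])
    (use loops_at_1[OF u] in \<open>auto simp: loop_cat_def intro!: continuous_intros\<close>)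

lemma loop_cat_rev_left:
  assumes S: "S \<subseteq> topspace W" and u: "u \<in> loops W S Z z0"
  shows "loop_homotopic W S Z z0 (loop_cat (loop_rev u) u) (\<lambda>_. z0)"
  by (rule loop_homotopic_reparam[OF S u, where f = "\<lambda>t. \<bar>1 - 2 * t\<bar>" and g = "\<lambda>t. 1"])
    (use loops_at_1[OF u] in \<open>auto simp: loop_cat_def loop_rev_def intro!: continuous_intros\<close>)

section \<open>Suspension classes as homotopy classes of loops\<close>

text \<open>
  The suspension of \<open>B = W / S\<close> as a quotient of \<open>W \<times> I\<close>.  Two cases are needed: \<open>W = B = A\<close> with \<open>S\<close> the
  base point, and \<open>W = A \<times> X\<close> with \<open>B\<close> the smash product.  In the second case \<open>B\<close> need not be locally
  compact, but \<open>W\<close> is, and all constructions take place on \<open>W\<close>.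
\<close>

locale suspension_cover =
  fixes W :: "'w topology" and S :: "'w set" and B :: "'b topology" and b0 :: 'b and q :: "'w \<Rightarrow> 'b"
  assumes locally_compact: "locally_compact_space W" and Hausdorff: "Hausdorff_space W"
    and S_subset: "S \<subseteq> topspace W" and S_nonempty: "S \<noteq> {}"
    and quotient: "quotient_map W B q"
    and q_base: "w \<in> topspace W \<Longrightarrow> q w = b0 \<longleftrightarrow> w \<in> S"
    and q_inj: "w \<in> topspace W \<Longrightarrow> w' \<in> topspace W \<Longrightarrow> w \<notin> S \<Longrightarrow> q w = q w' \<Longrightarrow> w = w'"
begin

definition cov :: "'w \<times> real \<Rightarrow> ('b \<times> real) set" where
  "cov p = collapse (susp_base B b0) (q (fst p), snd p)"

text \<open>
  The homotopy class of a map to which \<open>u\<close> descends, described without choosing such a map.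
\<close>

definition loop_class :: "'z topology \<Rightarrow> 'z \<Rightarrow> ('w \<times> real \<Rightarrow> 'z) \<Rightarrow> (('b \<times> real) set \<Rightarrow> 'z) set" where
  "loop_class Z z0 u = {g. loop_homotopic W S Z z0 u (\<lambda>p. g (cov p))}"

lemma q_in: "w \<in> topspace W \<Longrightarrow> q w \<in> topspace B"
  using quotient quotient_imp_surjective_map by fastforce

lemma base_iff:
  assumes "p \<in> topspace (prod_topology W \<I>)"
  shows "(q (fst p), snd p) \<in> susp_base B b0 \<longleftrightarrow> p \<in> loop_base W S"
  using assms q_in q_base S_subset
  by (cases p) (auto simp: susp_base_def loop_base_def)

lemma loop_base_subset: "loop_base W S \<subseteq> topspace (prod_topology W \<I>)"
  using S_subset by (auto simp: loop_base_def)

lemma cov_base: "p \<in> loop_base W S \<Longrightarrow> cov p = susp_base B b0"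
  using base_iff[of p] loop_base_subset by (auto simp: cov_def collapse_def)

lemma loop_base_nonempty: "loop_base W S \<noteq> {}"
  using S_nonempty by (auto simp: loop_base_def)

lemma cov_eq:
  assumes "p \<in> topspace (prod_topology W \<I>)" "p' \<in> topspace (prod_topology W \<I>)" "cov p = cov p'"
  shows "p = p' \<or> p \<in> loop_base W S \<and> p' \<in> loop_base W S"
proof (cases "p \<in> loop_base W S \<or> p' \<in> loop_base W S")
  case True
  then have "p \<in> loop_base W S \<and> p' \<in> loop_base W S"
    using assms base_iff[of p] base_iff[of p'] unfolding cov_def collapse_def
    by (metis insertI1)
  then show ?thesis by simp
next
  case False
  then have "q (fst p) = q (fst p')" "snd p = snd p'"
    using assms base_iff[of p] base_iff[of p'] unfolding cov_def collapse_def by auto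
  moreover have "fst p \<notin> S" using False assms(1) by (cases p) (auto simp: loop_base_def)
  ultimately have "fst p = fst p'"
    using assms(1,2) q_inj[of "fst p" "fst p'"] by (cases p; cases p') auto
  with \<open>snd p = snd p'\<close> show ?thesis by (simp add: prod_eq_iff)
qed

lemma quotient_cov: "quotient_map (prod_topology W \<I>) (susp B b0) cov"
proof -
  have "quotient_map (prod_topology W \<I>) (prod_topology B \<I>) (\<lambda>(x, y). (q x, y))"
    using locally_compact_space_unit_interval Hausdorff_space_unit_interval quotient
    by (intro quotient_map_prod_left) auto
  then have "quotient_map (prod_topology W \<I>) (susp B b0)
      (collapse (susp_base B b0) \<circ> (\<lambda>(x, y). (q x, y)))"
    unfolding susp_def by (rule quotient_map_compose[OF _ quotient_map_collapse])
  moreover have "collapse (susp_base B b0) \<circ> (\<lambda>(x, y). (q x, y)) = cov"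
    by (auto simp: cov_def)
  ultimately show ?thesis by simp
qed

lemma cov_in: "p \<in> topspace (prod_topology W \<I>) \<Longrightarrow> cov p \<in> topspace (susp B b0)"
  using quotient_imp_surjective_map[OF quotient_cov] by blast

lemma based_maps_iff:
  "f \<in> based_maps (susp B b0) (susp_base B b0) Z z0 \<longleftrightarrow> (\<lambda>p. f (cov p)) \<in> loops W S Z z0"
proof -
  have "continuous_map (susp B b0) Z f \<longleftrightarrow> continuous_map (prod_topology W \<I>) Z (\<lambda>p. f (cov p))"
    using continuous_compose_quotient_map_eq[OF quotient_cov, of Z f] by (simp add: o_def)
  moreover have "f (susp_base B b0) = z0 \<longleftrightarrow> (\<forall>p\<in>loop_base W S. f (cov p) = z0)"
    using loop_base_nonempty by (auto simp: cov_base)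
  ultimately show ?thesis by (simp add: based_maps_def loops_def)
qed

lemma loop_class_cong:
  assumes "u \<in> loops W S Z z0" "\<And>p. p \<in> topspace (prod_topology W \<I>) \<Longrightarrow> u p = v p"
  shows "v \<in> loops W S Z z0" "loop_homotopic W S Z z0 u v" "loop_class Z z0 u = loop_class Z z0 v"
proof -
  show v: "v \<in> loops W S Z z0"
    using assms subsetD[OF loop_base_subset] unfolding loops_def
    by (auto simp del: topspace_prod_topology intro: continuous_map_eq)
  show uv: "loop_homotopic W S Z z0 u v"
    using assms v unfolding loop_homotopic_def loops_def by (intro homotopic_with_equal) auto
  show "loop_class Z z0 u = loop_class Z z0 v"
    using uv unfolding loop_class_def by (blast intro: loop_homotopic_trans loop_homotopic_sym)
qed

lemma loop_descends:
  assumes "u \<in> loops W S Z z0"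
  obtains f where "f \<in> based_maps (susp B b0) (susp_base B b0) Z z0"
    "loop_homotopic W S Z z0 u (\<lambda>p. f (cov p))"
proof -
  have "u p = u p'" if "p \<in> topspace (prod_topology W \<I>)" "p' \<in> topspace (prod_topology W \<I>)"
    "cov p = cov p'" for p p'
    using cov_eq[OF that] loops_at_base[OF assms] by metis
  then obtain f where "\<And>p. p \<in> topspace (prod_topology W \<I>) \<Longrightarrow> f (cov p) = u p"
    using quotient_map_lift_exists[OF quotient_cov loops_continuous[OF assms]] by metis
  with loop_class_cong[OF assms, of "\<lambda>p. f (cov p)"] show ?thesis
    by (intro that[of f]) (auto simp: based_maps_iff)
qed

text \<open>
  Homotopies of loops descend to the suspension because the product of the quotient map with the
  locally compact interval is again a quotient map.
\<close>

lemma hclass_eq_loop_class: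
  "hclass (susp B b0) (susp_base B b0) Z z0 f = loop_class Z z0 (\<lambda>p. f (cov p))"
proof -
  have "homotopic_with (\<lambda>h. h (susp_base B b0) = z0) (susp B b0) Z f g"
    if gh: "loop_homotopic W S Z z0 (\<lambda>p. f (cov p)) (\<lambda>p. g (cov p))" for g
  proof -
    obtain H where H: "continuous_map (prod_topology (prod_topology W \<I>) \<I>) Z H"
      "\<And>p s. p \<in> loop_base W S \<Longrightarrow> 0 \<le> s \<Longrightarrow> s \<le> 1 \<Longrightarrow> H (p, s) = z0"
      "\<And>p. H (p, 0) = f (cov p)" "\<And>p. H (p, 1) = g (cov p)"
      using loop_homotopicE[OF gh] by blast
    have Q: "quotient_map (prod_topology (prod_topology W \<I>) \<I>) (prod_topology (susp B b0) \<I>)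
        (\<lambda>(x, y). (cov x, y))"
      using locally_compact_space_unit_interval Hausdorff_space_unit_interval quotient_cov
      by (intro quotient_map_prod_left) auto
    have "H x = H y" if "x \<in> topspace (prod_topology (prod_topology W \<I>) \<I>)"
      "y \<in> topspace (prod_topology (prod_topology W \<I>) \<I>)"
      "(\<lambda>(x, y). (cov x, y)) x = (\<lambda>(x, y). (cov x, y)) y" for x y
    proof -
      obtain p s p' s' where xy: "x = (p, s)" "y = (p', s')" by (cases x, cases y) auto
      with that have "p \<in> topspace (prod_topology W \<I>)" "p' \<in> topspace (prod_topology W \<I>)"
        "cov p = cov p'" "s' = s" "0 \<le> s" "s \<le> 1" by auto
      with cov_eq[of p p'] H(2)[of p s] H(2)[of p' s] xy show ?thesis by metis
    qed
    then obtain K where K: "continuous_map (prod_topology (susp B b0) \<I>) Z K"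
      "\<And>x. x \<in> topspace (prod_topology (prod_topology W \<I>) \<I>) \<Longrightarrow> K ((\<lambda>(x, y). (cov x, y)) x) = H x"
      using quotient_map_lift_exists[OF Q H(1)] by metis
    have K': "K (cov p, s) = H (p, s)" if "p \<in> topspace (prod_topology W \<I>)" "0 \<le> s" "s \<le> 1" for p s
      using K(2)[of "(p, s)"] that by (auto simp: mem_Times_iff)
    have onto: "\<exists>p\<in>topspace (prod_topology W \<I>). x = cov p" if "x \<in> topspace (susp B b0)" for x
      using quotient_imp_surjective_map[OF quotient_cov] that by blast
    obtain p0 where p0: "p0 \<in> loop_base W S" using loop_base_nonempty by blast
    then have b: "susp_base B b0 = cov p0" "p0 \<in> topspace (prod_topology W \<I>)"
      using cov_base loop_base_subset by auto
    then have bt: "susp_base B b0 \<in> topspace (susp B b0)" using cov_in by metis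
    have c: "continuous_map (prod_topology \<I> (susp B b0)) Z (\<lambda>p. K (snd p, fst p))"
      by (rule continuous_map_compose'[OF _ K(1)]) (rule cont_intros)+
    show ?thesis
    proof (subst homotopic_with)
      show "\<exists>h. continuous_map (prod_topology \<I> (susp B b0)) Z h \<and>
        (\<forall>x\<in>topspace (susp B b0). h (0, x) = f x) \<and> (\<forall>x\<in>topspace (susp B b0). h (1, x) = g x) \<and>
        (\<forall>t\<in>{0..1}. h (t, susp_base B b0) = z0)"
      proof (intro exI[of _ "\<lambda>p. K (snd p, fst p)"] conjI ballI c)
        fix x assume "x \<in> topspace (susp B b0)"
        then obtain p where "p \<in> topspace (prod_topology W \<I>)" "x = cov p" using onto by blast
        then show "K (snd (0, x), fst (0, x)) = f x" "K (snd (1, x), fst (1, x)) = g x"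
          using K' H by simp_all
      next
        fix t :: real assume "t \<in> {0..1}"
        then show "K (snd (t, susp_base B b0), fst (t, susp_base B b0)) = z0"
          using K'[OF b(2)] H(2)[OF p0] b(1) by simp
      qed
    qed (use bt in auto)
  qed
  moreover have "loop_homotopic W S Z z0 (\<lambda>p. f (cov p)) (\<lambda>p. g (cov p))"
    if "homotopic_with (\<lambda>h. h (susp_base B b0) = z0) (susp B b0) Z f g" for g
    using homotopic_with_compose_continuous_map_right[OF that quotient_imp_continuous_map[OF quotient_cov],
        of "\<lambda>h. \<forall>p\<in>loop_base W S. h p = z0"]
    unfolding loop_homotopic_def o_def by (simp add: cov_base)
  ultimately show ?thesis
    unfolding hclass_def loop_class_def by blast
qed

lemma loop_class_eqI: "loop_homotopic W S Z z0 u v \<Longrightarrow> loop_class Z z0 u = loop_class Z z0 v"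
  unfolding loop_class_def by (blast intro: loop_homotopic_trans loop_homotopic_sym)

lemma loop_class_eqD:
  assumes v: "v \<in> loops W S Z z0" and eq: "loop_class Z z0 u = loop_class Z z0 v"
  shows "loop_homotopic W S Z z0 u v"
proof -
  obtain f where "loop_homotopic W S Z z0 v (\<lambda>p. f (cov p))" using loop_descends[OF v] by blast
  moreover from this have "loop_homotopic W S Z z0 u (\<lambda>p. f (cov p))"
    using eq unfolding loop_class_def by blast
  ultimately show ?thesis by (blast intro: loop_homotopic_trans loop_homotopic_sym)
qed

lemma carrier_susp_group: "carrier (susp_group B b0 Z z0) = loop_class Z z0 ` loops W S Z z0"
proof -
  have "loop_class Z z0 u \<in> hclasses (susp B b0) (susp_base B b0) Z z0" if u: "u \<in> loops W S Z z0" for u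
  proof -
    obtain f where "f \<in> based_maps (susp B b0) (susp_base B b0) Z z0"
      "loop_homotopic W S Z z0 u (\<lambda>p. f (cov p))" using loop_descends[OF u] by blast
    then show ?thesis
      by (auto simp: hclasses_def hclass_eq_loop_class dest: loop_class_eqI)
  qed
  then show ?thesis
    by (auto simp: susp_group_def hclasses_def hclass_eq_loop_class based_maps_iff)
qed

lemma one_susp_group: "\<one>\<^bsub>susp_group B b0 Z z0\<^esub> = loop_class Z z0 (\<lambda>_. z0)"
  by (simp add: susp_group_def hclass_eq_loop_class)

lemma susp_add_cov:
  assumes "f \<in> based_maps (susp B b0) (susp_base B b0) Z z0" "g \<in> based_maps (susp B b0) (susp_base B b0) Z z0"
    and "p \<in> topspace (prod_topology W \<I>)"
  shows "susp_add B b0 f g (cov p) = loop_cat (\<lambda>p. f (cov p)) (\<lambda>p. g (cov p)) p"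
  using susp_add_collapse[of f B b0 z0 g "q (fst p)" "snd p"] assms q_in
  by (cases p) (auto simp: based_maps_def cov_def loop_cat_def)

lemma mult_susp_group:
  assumes u: "u \<in> loops W S Z z0" and v: "v \<in> loops W S Z z0"
  shows "loop_class Z z0 u \<otimes>\<^bsub>susp_group B b0 Z z0\<^esub> loop_class Z z0 v = loop_class Z z0 (loop_cat u v)"
proof -
  have *: "hclass (susp B b0) (susp_base B b0) Z z0 (susp_add B b0 f g) = loop_class Z z0 (loop_cat u v)"
    if f: "f \<in> loop_class Z z0 u" and g: "g \<in> loop_class Z z0 v" for f g
  proof -
    have fg: "loop_homotopic W S Z z0 u (\<lambda>p. f (cov p))" "loop_homotopic W S Z z0 v (\<lambda>p. g (cov p))"
      using f g by (auto simp: loop_class_def)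
    then have b: "f \<in> based_maps (susp B b0) (susp_base B b0) Z z0"
        "g \<in> based_maps (susp B b0) (susp_base B b0) Z z0"
      by (auto simp: based_maps_iff dest: loop_homotopic_loops)
    have "loop_cat (\<lambda>p. f (cov p)) (\<lambda>p. g (cov p)) \<in> loops W S Z z0"
      using fg by (intro loops_cat loop_homotopic_loops)
    then have "loop_class Z z0 (loop_cat (\<lambda>p. f (cov p)) (\<lambda>p. g (cov p)))
        = loop_class Z z0 (\<lambda>p. susp_add B b0 f g (cov p))"
      by (rule loop_class_cong) (simp add: susp_add_cov[OF b])
    moreover have "loop_class Z z0 (loop_cat u v) = loop_class Z z0 (loop_cat (\<lambda>p. f (cov p)) (\<lambda>p. g (cov p)))"
      by (intro loop_class_eqI loop_homotopic_cat fg S_subset)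
    ultimately show ?thesis by (simp only: hclass_eq_loop_class)
  qed
  obtain f g where "f \<in> loop_class Z z0 u" "g \<in> loop_class Z z0 v"
    using loop_descends[OF u] loop_descends[OF v] unfolding loop_class_def by (metis mem_Collect_eq)
  with * have "(\<Union>f\<in>loop_class Z z0 u. \<Union>g\<in>loop_class Z z0 v.
      hclass (susp B b0) (susp_base B b0) Z z0 (susp_add B b0 f g)) = loop_class Z z0 (loop_cat u v)"
    by blast
  then show ?thesis by (simp add: susp_group_def)
qed

lemma susp_induced_loop_class:
  assumes u: "u \<in> loops W S Z z0" and \<phi>: "continuous_map Z Z' \<phi>" "\<phi> z0 = z0'"
  shows "susp_induced B b0 Z' z0' \<phi> (loop_class Z z0 u) = loop_class Z' z0' (\<lambda>p. \<phi> (u p))"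
proof -
  obtain f where f: "f \<in> based_maps (susp B b0) (susp_base B b0) Z z0"
    "loop_homotopic W S Z z0 u (\<lambda>p. f (cov p))" using loop_descends[OF u] by blast
  have "susp_induced B b0 Z' z0' \<phi> (loop_class Z z0 u) = loop_class Z' z0' (\<lambda>p. \<phi> (f (cov p)))"
    using induced_hclass[OF \<phi> f(1)] loop_class_eqI[OF f(2)]
    by (simp add: susp_induced_def hclass_eq_loop_class)
  also have "\<dots> = loop_class Z' z0' (\<lambda>p. \<phi> (u p))"
    using loop_homotopic_compose[OF f(2) \<phi>] by (auto dest: loop_class_eqI)
  finally show ?thesis .
qed

lemma group_susp_group:
  assumes z0: "z0 \<in> topspace Z"
  shows "group (susp_group B b0 Z z0)"
proof (rule groupI)
  fix x y assume "x \<in> carrier (susp_group B b0 Z z0)" "y \<in> carrier (susp_group B b0 Z z0)"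
  then show "x \<otimes>\<^bsub>susp_group B b0 Z z0\<^esub> y \<in> carrier (susp_group B b0 Z z0)"
    by (auto simp: carrier_susp_group mult_susp_group loops_cat)
next
  show "\<one>\<^bsub>susp_group B b0 Z z0\<^esub> \<in> carrier (susp_group B b0 Z z0)"
    using z0 by (auto simp: carrier_susp_group one_susp_group loops_const)
next
  fix x y z assume "x \<in> carrier (susp_group B b0 Z z0)" "y \<in> carrier (susp_group B b0 Z z0)"
    "z \<in> carrier (susp_group B b0 Z z0)"
  then obtain u v w where "u \<in> loops W S Z z0" "x = loop_class Z z0 u" "v \<in> loops W S Z z0"
    "y = loop_class Z z0 v" "w \<in> loops W S Z z0" "z = loop_class Z z0 w"
    by (auto simp: carrier_susp_group)
  then show "x \<otimes>\<^bsub>susp_group B b0 Z z0\<^esub> y \<otimes>\<^bsub>susp_group B b0 Z z0\<^esub> z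
      = x \<otimes>\<^bsub>susp_group B b0 Z z0\<^esub> (y \<otimes>\<^bsub>susp_group B b0 Z z0\<^esub> z)"
    using loop_class_eqI[OF loop_cat_assoc[OF S_subset]] by (simp add: mult_susp_group loops_cat)
next
  fix x assume "x \<in> carrier (susp_group B b0 Z z0)"
  then obtain u where u: "u \<in> loops W S Z z0" "x = loop_class Z z0 u"
    by (auto simp: carrier_susp_group)
  show "\<one>\<^bsub>susp_group B b0 Z z0\<^esub> \<otimes>\<^bsub>susp_group B b0 Z z0\<^esub> x = x"
    using loop_class_eqI[OF loop_cat_const_left[OF S_subset u(1)]] u z0
    by (simp add: one_susp_group mult_susp_group loops_const)
  have "loop_class Z z0 (loop_rev u) \<in> carrier (susp_group B b0 Z z0)"
    using u by (simp add: loops_rev carrier_susp_group)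
  moreover have "loop_class Z z0 (loop_rev u) \<otimes>\<^bsub>susp_group B b0 Z z0\<^esub> x = \<one>\<^bsub>susp_group B b0 Z z0\<^esub>"
    using loop_class_eqI[OF loop_cat_rev_left[OF S_subset u(1)]] u
    by (simp add: one_susp_group mult_susp_group loops_rev)
  ultimately show "\<exists>y\<in>carrier (susp_group B b0 Z z0). y \<otimes>\<^bsub>susp_group B b0 Z z0\<^esub> x = \<one>\<^bsub>susp_group B b0 Z z0\<^esub>"
    by blast
qed

lemma hom_susp_induced:
  assumes \<phi>: "continuous_map Z Z' \<phi>" "\<phi> z0 = z0'"
  shows "susp_induced B b0 Z' z0' \<phi> \<in> hom (susp_group B b0 Z z0) (susp_group B b0 Z' z0')"
proof (rule homI)
  fix x assume "x \<in> carrier (susp_group B b0 Z z0)"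
  then obtain u where u: "u \<in> loops W S Z z0" "x = loop_class Z z0 u"
    by (auto simp: carrier_susp_group)
  then show "susp_induced B b0 Z' z0' \<phi> x \<in> carrier (susp_group B b0 Z' z0')"
    using loops_compose[OF u(1) \<phi>] by (simp add: carrier_susp_group susp_induced_loop_class[OF _ \<phi>])
next
  fix x y assume "x \<in> carrier (susp_group B b0 Z z0)" "y \<in> carrier (susp_group B b0 Z z0)"
  then obtain u v where uv: "u \<in> loops W S Z z0" "x = loop_class Z z0 u"
    "v \<in> loops W S Z z0" "y = loop_class Z z0 v" by (auto simp: carrier_susp_group)
  have "(\<lambda>p. \<phi> (loop_cat u v p)) = loop_cat (\<lambda>p. \<phi> (u p)) (\<lambda>p. \<phi> (v p))"
    by (auto simp: loop_cat_def)
  then show "susp_induced B b0 Z' z0' \<phi> (x \<otimes>\<^bsub>susp_group B b0 Z z0\<^esub> y)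
      = susp_induced B b0 Z' z0' \<phi> x \<otimes>\<^bsub>susp_group B b0 Z' z0'\<^esub> susp_induced B b0 Z' z0' \<phi> y"
    using uv loops_compose[OF uv(1) \<phi>] loops_compose[OF uv(3) \<phi>] loops_cat[OF uv(1,3)]
    by (simp add: mult_susp_group susp_induced_loop_class[OF _ \<phi>])
qed

end

section \<open>Gottlieb groups\<close>

text \<open>
  All loops of a homotopy begin at \<open>c\<close>, so running along the loops connects each value to \<open>c\<close>.
\<close>

lemma loop_homotopic_path_component:
  assumes S: "S \<subseteq> topspace W" and uv: "loop_homotopic W S T c u v"
  shows "loop_homotopic W S (subtopology T (path_component_of_set T c)) c u v"
proof -
  obtain H where H: "continuous_map (prod_topology (prod_topology W \<I>) \<I>) T H"
    "\<And>p s. p \<in> loop_base W S \<Longrightarrow> 0 \<le> s \<Longrightarrow> s \<le> 1 \<Longrightarrow> H (p, s) = c"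
    "\<And>p. H (p, 0) = u p" "\<And>p. H (p, 1) = v p"
    using loop_homotopicE[OF uv] by blast
  have "H ((w, t), s) \<in> path_component_of_set T c"
    if w: "w \<in> topspace W" and t: "t \<in> {0..1}" and s: "s \<in> {0..1}" for w t s
  proof -
    let ?h = "\<lambda>p. H ((fst (fst p), snd p), snd (fst p))"
    have h: "continuous_map (prod_topology (prod_topology W \<I>) \<I>) T ?h"
      by (rule continuous_map_compose'[OF _ H(1)]) (rule cont_intros)+
    have b: "H ((w, 0), s) = c" using H(2)[of "(w, 0)" s] w s by (auto simp: loop_base_def)
    have "((w, 0), s) \<in> topspace (prod_topology (prod_topology W \<I>) \<I>)" using w s by simp
    then have "c \<in> topspace T"
      using continuous_map_image_subset_topspace[OF H(1)] b by blast
    then have "path_component_of T c (?h ((w, s), 0))"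
      using b by (simp add: path_component_of_refl)
    moreover have "(w, s) \<in> topspace (prod_topology W \<I>)" using w s by simp
    ultimately have "path_component_of T c (?h ((w, s), t))"
      using path_component_slide[OF h _ _ t] by blast
    then show ?thesis by simp
  qed
  then have c: "continuous_map (prod_topology (prod_topology W \<I>) \<I>) (subtopology T (path_component_of_set T c)) H"
    using H(1) by (auto simp: continuous_map_in_subtopology)
  show ?thesis
    by (rule loop_homotopicI[OF S c]) (use H in auto)
qed

lemma loops_path_component:
  assumes "S \<subseteq> topspace W" "u \<in> loops W S T c"
  shows "u \<in> loops W S (subtopology T (path_component_of_set T c)) c"
  using loop_homotopic_path_component[OF assms(1) loop_homotopic_refl[OF assms(2)]]
  by (rule loop_homotopic_loops)

lemma id_map_in_aut1: "id_map Z \<in> topspace (aut1 Z)"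
proof -
  have "continuous_map Z Z (id_map Z)"
    by (rule continuous_map_eq[OF continuous_map_id]) (simp add: id_map_def)
  then have "id_map Z \<in> topspace (compact_open Z Z)"
    by (simp add: topspace_compact_open cmaps_def id_map_def)
  then show ?thesis
    by (simp add: aut1_def path_component_of_refl)
qed

lemma continuous_map_eval_aut1: "z0 \<in> topspace Z \<Longrightarrow> continuous_map (aut1 Z) Z (\<lambda>g. g z0)"
  unfolding aut1_def by (intro continuous_map_from_subtopology continuous_map_eval_point)

lemma continuous_map_aut1: "continuous_map P (aut1 Z) F \<Longrightarrow> continuous_map P (compact_open Z Z) F"
  unfolding aut1_def by (rule continuous_map_into_fulltopology)

lemma loops_aut1_at_base:
  "F \<in> loops W S (aut1 Z) (id_map Z) \<Longrightarrow> p \<in> loop_base W S \<Longrightarrow> z \<in> topspace Z \<Longrightarrow> F p z = z"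
  by (simp add: loops_def id_map_def)

context suspension_cover
begin

lemma carrier_gottlieb:
  assumes z0: "z0 \<in> topspace Z"
  shows "carrier (gottlieb B b0 Z z0) =
    (\<lambda>F. loop_class Z z0 (\<lambda>p. F p z0)) ` loops W S (aut1 Z) (id_map Z)"
proof -
  have "id_map Z z0 = z0" using z0 by (simp add: id_map_def)
  then show ?thesis
    using susp_induced_loop_class[OF _ continuous_map_eval_aut1[OF z0]]
    by (auto simp: gottlieb_def carrier_susp_group image_image intro!: image_eqI)
qed

lemma gottlieb_loops:
  assumes z0: "z0 \<in> topspace Z" and F: "F \<in> loops W S (aut1 Z) (id_map Z)"
  shows "(\<lambda>p. F p z0) \<in> loops W S Z z0"
  by (rule loops_compose[OF F continuous_map_eval_aut1[OF z0]]) (simp add: id_map_def z0)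

text \<open>
  The curried map \<open>p \<mapsto> k(p, _)\<close> is continuous for every \<open>Z\<close>, and it stays in the component of the
  identity because its loops start there.
\<close>

lemma gottliebI:
  assumes z0: "z0 \<in> topspace Z"
    and k: "continuous_map (prod_topology (prod_topology W \<I>) Z) Z k"
    and base: "\<And>p z. p \<in> loop_base W S \<Longrightarrow> z \<in> topspace Z \<Longrightarrow> k (p, z) = z"
    and u: "\<And>p. p \<in> topspace (prod_topology W \<I>) \<Longrightarrow> k (p, z0) = u p"
  shows "loop_class Z z0 u \<in> carrier (gottlieb B b0 Z z0)" "u \<in> loops W S Z z0"
proof -
  let ?F = "\<lambda>p. \<lambda>z\<in>topspace Z. k (p, z)"
  have "?F \<in> loops W S (compact_open Z Z) (id_map Z)"
    using continuous_map_curry[OF k] base by (auto simp: loops_def id_map_def intro: restrict_ext)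
  then have F: "?F \<in> loops W S (aut1 Z) (id_map Z)"
    unfolding aut1_def by (rule loops_path_component[OF S_subset])
  have "?F p z0 = u p" if "p \<in> topspace (prod_topology W \<I>)" for p
    using u[OF that] z0 by simp
  note * = loop_class_cong[OF gottlieb_loops[OF z0 F] this]
  show "u \<in> loops W S Z z0" by (rule *)
  show "loop_class Z z0 u \<in> carrier (gottlieb B b0 Z z0)"
    unfolding carrier_gottlieb[OF z0] by (rule image_eqI[OF _ F]) (rule *(3)[symmetric])
qed

lemma gottlieb_mult: "(\<otimes>\<^bsub>gottlieb B b0 Z z0\<^esub>) = (\<otimes>\<^bsub>susp_group B b0 Z z0\<^esub>)"
  and gottlieb_one: "\<one>\<^bsub>gottlieb B b0 Z z0\<^esub> = \<one>\<^bsub>susp_group B b0 Z z0\<^esub>"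
  by (simp_all add: gottlieb_def)

lemma subgroup_gottlieb:
  assumes z0: "z0 \<in> topspace Z"
  shows "subgroup (carrier (gottlieb B b0 Z z0)) (susp_group B b0 Z z0)"
proof -
  have "susp_induced B b0 Z z0 (\<lambda>g. g z0) \<in> hom (susp_group B b0 (aut1 Z) (id_map Z)) (susp_group B b0 Z z0)"
    using z0 by (intro hom_susp_induced continuous_map_eval_aut1) (simp_all add: id_map_def)
  then have "group_hom (susp_group B b0 (aut1 Z) (id_map Z)) (susp_group B b0 Z z0)
      (susp_induced B b0 Z z0 (\<lambda>g. g z0))"
    by (simp add: group_hom_def group_hom_axioms_def group_susp_group id_map_in_aut1 z0)
  from group_hom.img_is_subgroup[OF this] show ?thesis
    by (simp add: gottlieb_def)
qed

text \<open>
  On the square \<open>(s, t) \<mapsto> F(w, s)(g(w, t))\<close>, the path through the corner \<open>(1, 0)\<close> reads \<open>F(_, z0)\<close> and then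
  \<open>g\<close>, the path through \<open>(0, 1)\<close> reads them in the other order.
\<close>

lemma gottlieb_commute:
  assumes z0: "z0 \<in> topspace Z" and F: "F \<in> loops W S (aut1 Z) (id_map Z)" and g: "g \<in> loops W S Z z0"
  shows "loop_homotopic W S Z z0 (loop_cat (\<lambda>p. F p z0) g) (loop_cat g (\<lambda>p. F p z0))"
proof -
  let ?Q = "\<lambda>p. F (fst p, fst (snd p)) (g (fst p, snd (snd p)))"
  have lc: "locally_compact_space (prod_topology W \<I>)" "Hausdorff_space (prod_topology W \<I>)"
    using locally_compact Hausdorff locally_compact_space_unit_interval Hausdorff_space_unit_interval
    by (auto simp: locally_compact_space_prod_topology Hausdorff_space_prod_topology)
  have e: "continuous_map (prod_topology (prod_topology W \<I>) (prod_topology W \<I>)) Z (\<lambda>p. F (fst p) (g (snd p)))"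
    by (rule continuous_map_eval_along[OF continuous_map_aut1[OF loops_continuous[OF F]] loops_continuous[OF g] lc])
  have "continuous_map (prod_topology W (prod_topology \<I> \<I>)) (prod_topology (prod_topology W \<I>) (prod_topology W \<I>))
      (\<lambda>p. ((fst p, fst (snd p)), (fst p, snd (snd p))))"
    by (rule cont_intros)+
  from continuous_map_compose'[OF this e]
  have Q: "continuous_map (prod_topology W (prod_topology \<I> \<I>)) Z ?Q" by simp
  have gZ: "g (w, t) \<in> topspace Z" if "w \<in> topspace W" "0 \<le> t" "t \<le> 1" for w t
    using continuous_map_image_subset_topspace[OF loops_continuous[OF g]] that by fastforce
  have F1: "F (w, t) z = z" if "w \<in> topspace W" "t = 0 \<or> t = 1" "z \<in> topspace Z" for w t z
    using loops_aut1_at_base[OF F, of "(w, t)" z] that by (auto simp: loop_base_def)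
  have FS: "F (w, t) z = z" if "w \<in> S" "0 \<le> t" "t \<le> 1" "z \<in> topspace Z" for w t z
    using loops_aut1_at_base[OF F, of "(w, t)" z] that by (auto simp: loop_base_def)
  show ?thesis
  proof (rule loop_homotopic_paths[OF S_subset Q, where f = "\<lambda>t. min 1 (2 * t)" and g = "\<lambda>t. max 0 (2 * t - 1)"
        and f' = "\<lambda>t. max 0 (2 * t - 1)" and g' = "\<lambda>t. min 1 (2 * t)"])
    fix w and t :: real assume "w \<in> topspace W" "0 \<le> t" "t \<le> 1"
    then show "loop_cat (\<lambda>p. F p z0) g (w, t) = ?Q (w, min 1 (2 * t), max 0 (2 * t - 1))"
      "loop_cat g (\<lambda>p. F p z0) (w, t) = ?Q (w, max 0 (2 * t - 1), min 1 (2 * t))"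
      using F1[of w] gZ[of w] loops_at_0[OF g, of w] loops_at_1[OF g, of w]
      by (cases "t \<le> 1/2"; simp add: loop_cat_def)+
  qed (use F1 FS loops_at_0[OF g] loops_at_1[OF g] loops_at_S[OF g] z0 in
      \<open>auto intro!: continuous_intros\<close>)
qed

lemma comm_group_gottlieb:
  assumes z0: "z0 \<in> topspace Z"
  shows "comm_group (gottlieb B b0 Z z0)"
proof -
  have "group (susp_group B b0 Z z0\<lparr>carrier := carrier (gottlieb B b0 Z z0)\<rparr>)"
    by (rule subgroup.subgroup_is_group[OF subgroup_gottlieb[OF z0] group_susp_group[OF z0]])
  then have "group (gottlieb B b0 Z z0)" by (simp add: gottlieb_def)
  then show ?thesis
  proof (rule group.group_comm_groupI)
    fix x y assume "x \<in> carrier (gottlieb B b0 Z z0)" "y \<in> carrier (gottlieb B b0 Z z0)"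
    then obtain F G where F: "F \<in> loops W S (aut1 Z) (id_map Z)" "x = loop_class Z z0 (\<lambda>p. F p z0)"
      and G: "G \<in> loops W S (aut1 Z) (id_map Z)" "y = loop_class Z z0 (\<lambda>p. G p z0)"
      by (auto simp: carrier_gottlieb[OF z0])
    show "x \<otimes>\<^bsub>gottlieb B b0 Z z0\<^esub> y = y \<otimes>\<^bsub>gottlieb B b0 Z z0\<^esub> x"
      using loop_class_eqI[OF gottlieb_commute[OF z0 F(1) gottlieb_loops[OF z0 G(1)]]]
      by (simp add: F(2) G(2) gottlieb_mult mult_susp_group gottlieb_loops[OF z0 F(1)] gottlieb_loops[OF z0 G(1)])
  qed
qed

end

section \<open>Loops in the mapping space\<close>

locale gottlieb_mapping_space =
  fixes X :: "'x topology" and Y :: "'y topology" and A :: "'a topology"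
    and x0 :: 'x and y0 :: 'y and a0 :: 'a
  assumes X_lc: "locally_compact_space X" and X_Hd: "Hausdorff_space X" and X_wp: "well_pointed X x0"
    and Y_lc: "locally_compact_space Y" and Y_Hd: "Hausdorff_space Y"
    and Y_pc: "path_connected_space Y" and y0: "y0 \<in> topspace Y"
    and A_lc: "locally_compact_space A" and A_Hd: "Hausdorff_space A" and a0: "a0 \<in> topspace A"
begin

lemma x0: "x0 \<in> topspace X"
  using X_wp by (simp add: well_pointed_def)

abbreviation M :: "('x \<Rightarrow> 'y) topology" where "M \<equiv> map_null X Y y0"
abbreviation m0 :: "'x \<Rightarrow> 'y" where "m0 \<equiv> const_map X y0"
abbreviation AX :: "('a \<times> 'x) topology" where "AX \<equiv> prod_topology A X"
abbreviation wedge :: "('a \<times> 'x) set" where "wedge \<equiv> smash_base A a0 X x0"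
text \<open>
  Loops of \<open>M\<close> over \<open>A\<close> correspond to loops of \<open>Y\<close> over \<open>A \<times> X\<close> with base set \<open>fibre\<close>, whereas loops
  over the suspended smash product have the larger base set \<open>wedge\<close>.
\<close>

abbreviation fibre :: "('a \<times> 'x) set" where "fibre \<equiv> {a0} \<times> topspace X"

lemma AX_lc: "locally_compact_space AX" and AX_Hd: "Hausdorff_space AX"
  using X_lc X_Hd A_lc A_Hd
  by (auto simp: locally_compact_space_prod_topology Hausdorff_space_prod_topology)

lemma fibre_subset: "fibre \<subseteq> topspace AX"
  using a0 by auto

lemma fibre_wedge: "fibre \<subseteq> wedge"
  by (auto simp: smash_base_def)

sublocale base: suspension_cover A "{a0}" A a0 id
proof
  show "quotient_map A A id"
    by (auto simp: quotient_map_def Collect_conj_eq Int_absorb1)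
qed (use A_lc A_Hd a0 in auto)

sublocale smash: suspension_cover AX wedge "smash A a0 X x0" wedge "collapse wedge"
proof
  show "wedge \<subseteq> topspace AX" "wedge \<noteq> {}" using a0 x0 by (auto simp: smash_base_def)
  show "quotient_map AX (smash A a0 X x0) (collapse wedge)"
    unfolding smash_def by (rule quotient_map_collapse)
qed (use AX_lc AX_Hd in \<open>auto simp: collapse_def split: if_splits\<close>)

definition adj :: "(('a \<times> 'x) \<times> real \<Rightarrow> 'y) \<Rightarrow> 'a \<times> real \<Rightarrow> 'x \<Rightarrow> 'y" where
  "adj u p = (\<lambda>x\<in>topspace X. u ((fst p, x), snd p))"

definition coadj :: "('a \<times> real \<Rightarrow> 'x \<Rightarrow> 'y) \<Rightarrow> ('a \<times> 'x) \<times> real \<Rightarrow> 'y" where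
  "coadj U p = U (fst (fst p), snd p) (snd (fst p))"

lemma loop_base_fibre_iff:
  "x \<in> topspace X \<Longrightarrow> ((a, x), t) \<in> loop_base AX fibre \<longleftrightarrow> (a, t) \<in> loop_base A {a0}"
  by (auto simp: loop_base_def)

lemma m0_in: "m0 \<in> topspace M"
proof -
  have "continuous_map X Y m0"
    unfolding const_map_def by (rule continuous_map_eq[where f = "\<lambda>_. y0"]) (use y0 in auto)
  then show ?thesis
    by (simp add: map_null_def topspace_compact_open cmaps_def const_map_def path_component_of_refl)
qed

lemma M_into_compact_open: "continuous_map P M F \<Longrightarrow> continuous_map P (compact_open X Y) F"
  unfolding map_null_def by (rule continuous_map_into_fulltopology)

lemma M_extensional: "m \<in> topspace M \<Longrightarrow> m \<in> extensional (topspace X)"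
  by (simp add: map_null_def topspace_compact_open cmaps_def)

lemma M_apply: "m \<in> topspace M \<Longrightarrow> x \<in> topspace X \<Longrightarrow> m x \<in> topspace Y"
  by (auto simp: map_null_def topspace_compact_open cmaps_def continuous_map_def)

lemma continuous_map_eval_M: "x \<in> topspace X \<Longrightarrow> continuous_map M Y (\<lambda>m. m x)"
  unfolding map_null_def by (intro continuous_map_from_subtopology continuous_map_eval_point)

lemma continuous_map_uncurry_M:
  assumes "continuous_map P M F"
  shows "continuous_map (prod_topology P X) Y (\<lambda>p. F (fst p) (snd p))"
  using M_into_compact_open[OF assms] X_lc X_Hd by (rule continuous_map_uncurry)

lemma continuous_map_const_map: "continuous_map Y M (const_map X)"
proof -
  have "continuous_map Y (compact_open X Y) (\<lambda>y. \<lambda>x\<in>topspace X. fst (y, x))"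
    by (rule continuous_map_curry) (rule continuous_map_fst)
  then have c: "continuous_map Y (compact_open X Y) (const_map X)"
    by (simp add: const_map_def[abs_def])
  have "path_component_of (compact_open X Y) m0 (const_map X y)" if y: "y \<in> topspace Y" for y
  proof -
    obtain g where g: "pathin Y g" "g 0 = y0" "g 1 = y"
      using Y_pc y0 y unfolding path_connected_space_def by blast
    then have "pathin (compact_open X Y) (\<lambda>t. const_map X (g t))"
      using continuous_map_compose'[OF _ c] by (simp add: pathin_def)
    then show ?thesis
      unfolding path_component_of_def using g by (intro exI[of _ "\<lambda>t. const_map X (g t)"]) simp
  qed
  with c show ?thesis
    unfolding map_null_def by (auto simp: continuous_map_in_subtopology)
qed

lemma adj_homotopic:
  assumes uv: "loop_homotopic AX fibre Y y0 u v"
  shows "loop_homotopic A {a0} M m0 (adj u) (adj v)"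
proof -
  obtain H where H: "continuous_map (prod_topology (prod_topology AX \<I>) \<I>) Y H"
    "\<And>p s. p \<in> loop_base AX fibre \<Longrightarrow> 0 \<le> s \<Longrightarrow> s \<le> 1 \<Longrightarrow> H (p, s) = y0"
    "\<And>p. H (p, 0) = u p" "\<And>p. H (p, 1) = v p"
    using loop_homotopicE[OF uv] by blast
  let ?h = "\<lambda>p. H (((fst (fst (fst p)), snd p), snd (fst (fst p))), snd (fst p))"
  have "continuous_map (prod_topology (prod_topology (prod_topology A \<I>) \<I>) X) Y ?h"
    by (rule continuous_map_compose'[OF _ H(1)]) (rule cont_intros)+
  from continuous_map_curry[OF this]
  have c: "continuous_map (prod_topology (prod_topology A \<I>) \<I>) (compact_open X Y)
      (\<lambda>p. \<lambda>x\<in>topspace X. ?h (p, x))" .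
  show ?thesis
    unfolding map_null_def
  proof (rule loop_homotopic_path_component[OF base.S_subset], rule loop_homotopicI[OF base.S_subset c])
    fix p and s :: real assume p: "p \<in> loop_base A {a0}" and s: "0 \<le> s" "s \<le> 1"
    have "H (((fst p, x), snd p), s) = y0" if x: "x \<in> topspace X" for x
      using H(2)[of "((fst p, x), snd p)" s] p s loop_base_fibre_iff[OF x, of "fst p" "snd p"] by simp
    then show "(\<lambda>x\<in>topspace X. ?h ((p, s), x)) = m0"
      by (auto simp: const_map_def intro: restrict_ext)
  qed (auto simp: adj_def H)
qed

lemma adj_loops: "u \<in> loops AX fibre Y y0 \<Longrightarrow> adj u \<in> loops A {a0} M m0"
  by (rule loop_homotopic_loops(1)[OF adj_homotopic[OF loop_homotopic_refl]])

lemma coadj_homotopic: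
  assumes UV: "loop_homotopic A {a0} M m0 U V"
  shows "loop_homotopic AX fibre Y y0 (coadj U) (coadj V)"
proof -
  obtain H where H: "continuous_map (prod_topology (prod_topology A \<I>) \<I>) M H"
    "\<And>p s. p \<in> loop_base A {a0} \<Longrightarrow> 0 \<le> s \<Longrightarrow> s \<le> 1 \<Longrightarrow> H (p, s) = m0"
    "\<And>p. H (p, 0) = U p" "\<And>p. H (p, 1) = V p"
    using loop_homotopicE[OF UV] by blast
  have "continuous_map (prod_topology (prod_topology AX \<I>) \<I>) (prod_topology (prod_topology (prod_topology A \<I>) \<I>) X)
     (\<lambda>p. (((fst (fst (fst p)), snd (fst p)), snd p), snd (fst (fst p))))"
    by (rule cont_intros)+
  from continuous_map_compose'[OF this continuous_map_uncurry_M[OF H(1)]]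
  have c: "continuous_map (prod_topology (prod_topology AX \<I>) \<I>) Y
     (\<lambda>p. H ((fst (fst (fst p)), snd (fst p)), snd p) (snd (fst (fst p))))" by simp
  show ?thesis
  proof (rule loop_homotopicI[OF fibre_subset c])
    fix p and s :: real assume "p \<in> loop_base AX fibre" and s: "0 \<le> s" "s \<le> 1"
    moreover obtain a x t where p: "p = ((a, x), t)" by (cases p) auto
    ultimately have x: "x \<in> topspace X" and "(a, t) \<in> loop_base A {a0}"
      by (auto simp: loop_base_def)
    with H(2) s show "H ((fst (fst (fst (p, s))), snd (fst (p, s))), snd (p, s)) (snd (fst (fst (p, s)))) = y0"
      by (simp add: p const_map_def)
  qed (auto simp: coadj_def H)
qed

lemma coadj_adj: "x \<in> topspace X \<Longrightarrow> coadj (adj u) ((a, x), t) = u ((a, x), t)"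
  by (simp add: adj_def coadj_def)

lemma adj_loop_cat: "adj (loop_cat u v) = loop_cat (adj u) (adj v)"
  by (auto simp: adj_def loop_cat_def fun_eq_iff)

lemma loops_wedge_fibre: "loops AX wedge Y y0 \<subseteq> loops AX fibre Y y0"
  using fibre_wedge by (fastforce simp: loops_def loop_base_def)

section \<open>Loops that are constant along the wedge\<close>

text \<open>
  Here \<open>E(_, 0)\<close> is the product of \<open>u\<close> with the inverse of its restriction to \<open>x0\<close>.  Over \<open>x0\<close> this product
  runs \<open>u\<close> up to the time \<open>1 - \<bar>1 - 2t\<bar>\<close>, which increases to \<open>1\<close> and then decreases to \<open>0\<close>; scaling the time by
  \<open>1 - s\<close> contracts it.  The well-pointedness of \<open>X\<close> extends the contraction over \<open>X\<close>.  The test space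
  for the extension is the space of maps on the other factors with prescribed values on the base, which
  keeps the extended homotopy relative to the base.
\<close>

lemma reduce_along_basepoint:
  fixes V :: "'v topology"
  assumes V: "locally_compact_space V" "Hausdorff_space V"
    and u: "continuous_map (prod_topology (prod_topology AX \<I>) V) Y u"
    and base_u: "\<And>p v. p \<in> loop_base AX fibre \<Longrightarrow> v \<in> topspace V \<Longrightarrow> u (p, v) = b v"
  obtains E where "continuous_map (prod_topology (prod_topology (prod_topology AX \<I>) V) \<I>) Y E"
    "\<And>p v s. p \<in> loop_base AX fibre \<Longrightarrow> v \<in> topspace V \<Longrightarrow> 0 \<le> s \<Longrightarrow> s \<le> 1 \<Longrightarrow> E ((p, v), s) = b v"
    "\<And>p v. p \<in> topspace (prod_topology AX \<I>) \<Longrightarrow> v \<in> topspace V \<Longrightarrow>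
       E ((p, v), 0) = loop_cat (\<lambda>p. u (p, v)) (loop_rev (\<lambda>p. u (((fst (fst p), x0), snd p), v))) p"
    "\<And>a t v s. a \<in> topspace A \<Longrightarrow> 0 \<le> t \<Longrightarrow> t \<le> 1 \<Longrightarrow> v \<in> topspace V \<Longrightarrow> 0 \<le> s \<Longrightarrow> s \<le> 1 \<Longrightarrow>
       E ((((a, x0), t), v), s) = u (((a, x0), (1 - s) * (1 - \<bar>1 - 2 * t\<bar>)), v)"
proof -
  let ?N = "prod_topology (prod_topology A \<I>) V"
  have N: "locally_compact_space ?N" "Hausdorff_space ?N"
    using V A_lc A_Hd locally_compact_space_unit_interval Hausdorff_space_unit_interval
    by (auto simp: locally_compact_space_prod_topology Hausdorff_space_prod_topology)
  let ?Z = "subtopology (compact_open ?N Y)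
      {m. \<forall>p\<in>loop_base A {a0}. \<forall>v\<in>topspace V. m (p, v) = b v}"
  have bA: "p \<in> topspace (prod_topology A \<I>)" if "p \<in> loop_base A {a0}" for p
    using that a0 by (auto simp: loop_base_def)
  have bN: "(p, v) \<in> topspace ?N" if "p \<in> loop_base A {a0}" "v \<in> topspace V" for p v
    using bA[OF that(1)] that(2) by simp
  have ub: "u (((a, x), t), v) = b v" if "a \<in> topspace A" "x \<in> topspace X" "0 \<le> t" "t \<le> 1" "v \<in> topspace V"
      "t = 0 \<or> t = 1 \<or> a = a0" for a x t v
    by (rule base_u) (use that in \<open>auto simp: loop_base_def\<close>)

  \<comment> \<open>The product of \<open>u\<close> with the inverse of its restriction, with the loop time moved to the last factor.\<close>
  define c where "c = loop_cat (\<lambda>q. u (((fst (fst q)), snd q), snd (fst q)))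
      (loop_rev (\<lambda>q. u (((fst (fst (fst q)), x0), snd q), snd (fst q))))"
  have c: "continuous_map (prod_topology (prod_topology AX V) \<I>) Y c"
    unfolding c_def
  proof (rule continuous_map_loop_cat)
    have "continuous_map (prod_topology (prod_topology AX V) \<I>) (prod_topology (prod_topology AX \<I>) V)
       (\<lambda>q. ((fst (fst q), snd q), snd (fst q)))"
      by (rule cont_intros)+
    from continuous_map_compose'[OF this u]
    show "continuous_map (prod_topology (prod_topology AX V) \<I>) Y (\<lambda>q. u (((fst (fst q)), snd q), snd (fst q)))" .
    have "continuous_map (prod_topology (prod_topology AX V) \<I>) X (\<lambda>q. x0)" using x0 by simp
    then have "continuous_map (prod_topology (prod_topology AX V) \<I>) (prod_topology (prod_topology AX \<I>) V)
       (\<lambda>q. (((fst (fst (fst q)), x0), snd q), snd (fst q)))"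
      by - (rule cont_intros | assumption)+
    from continuous_map_loop_rev[OF continuous_map_compose'[OF this u]]
    show "continuous_map (prod_topology (prod_topology AX V) \<I>) Y
        (loop_rev (\<lambda>q. u (((fst (fst (fst q)), x0), snd q), snd (fst q))))" .
  next
    fix w assume "w \<in> topspace (prod_topology AX V)"
    then show "u ((fst (fst (w, 1)), snd (w, 1)), snd (fst (w, 1)))
        = loop_rev (\<lambda>q. u (((fst (fst (fst q)), x0), snd q), snd (fst q))) (w, 0)"
      using x0 by (auto simp: loop_rev_def ub)
  qed

  have f: "continuous_map X ?Z (\<lambda>x. \<lambda>n\<in>topspace ?N. c (((fst (fst n), x), snd n), snd (fst n)))"
  proof -
    have "continuous_map (prod_topology X ?N) (prod_topology (prod_topology AX V) \<I>)
        (\<lambda>p. (((fst (fst (snd p)), fst p), snd (snd p)), snd (fst (snd p))))"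
      by (rule cont_intros)+
    from continuous_map_curry[OF continuous_map_compose'[OF this c]]
    have "continuous_map X (compact_open ?N Y) (\<lambda>x. \<lambda>n\<in>topspace ?N. c (((fst (fst n), x), snd n), snd (fst n)))"
      by simp
    moreover have "c (((fst p, x), v), snd p) = b v"
      if "x \<in> topspace X" "p \<in> loop_base A {a0}" "v \<in> topspace V" for x p v
      using that a0 x0 by (auto simp: c_def loop_cat_def loop_rev_def loop_base_def ub)
    ultimately show ?thesis
      using bN by (auto simp: continuous_map_in_subtopology simp del: topspace_prod_topology)
  qed

  let ?k = "\<lambda>s t. (1 - s) * (1 - \<bar>1 - 2 * t\<bar>) :: real"
  have k01: "0 \<le> ?k s t \<and> ?k s t \<le> 1" if "0 \<le> s" "s \<le> 1" "0 \<le> t" "t \<le> 1" for s t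
    using that by (auto intro!: mult_nonneg_nonneg mult_le_one)
  have h: "pathin ?Z (\<lambda>s. \<lambda>n\<in>topspace ?N. u (((fst (fst n), x0), ?k s (snd (fst n))), snd n))"
    unfolding pathin_def
  proof -
    let ?P = "prod_topology \<I> ?N"
    have r: "continuous_map ?P euclideanreal fst"
      using continuous_map_fst[of \<I> ?N] by (simp add: continuous_map_in_subtopology)
    have "continuous_map ?P \<I> (\<lambda>p. snd (fst (snd p)))" by (rule cont_intros)+
    then have t: "continuous_map ?P euclideanreal (\<lambda>p. snd (fst (snd p)))"
      by (simp add: continuous_map_in_subtopology)
    have k: "continuous_map ?P \<I> (\<lambda>p. ?k (fst p) (snd (fst (snd p))))"
      unfolding continuous_map_unit_interval
    proof
      show "continuous_map ?P euclideanreal (\<lambda>p. ?k (fst p) (snd (fst (snd p))))"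
        by (intro continuous_intros r t) simp_all
    qed (use k01 in auto)
    have a: "continuous_map ?P A (\<lambda>p. fst (fst (snd p)))" and v: "continuous_map ?P V (\<lambda>p. snd (snd p))"
      by (rule cont_intros)+
    have "continuous_map ?P (prod_topology (prod_topology AX \<I>) V)
        (\<lambda>p. (((fst (fst (snd p)), x0), ?k (fst p) (snd (fst (snd p)))), snd (snd p)))"
      by (intro continuous_map_pairedI k a v) (simp add: x0)
    from continuous_map_curry[OF continuous_map_compose'[OF this u]]
    have "continuous_map \<I> (compact_open ?N Y)
        (\<lambda>s. \<lambda>n\<in>topspace ?N. u (((fst (fst n), x0), ?k s (snd (fst n))), snd n))"
      by simp
    moreover have "u (((fst p, x0), ?k s (snd p)), v) = b v"
      if "0 \<le> s" "s \<le> 1" "p \<in> loop_base A {a0}" "v \<in> topspace V" for s p v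
    proof (rule ub)
      have "fst p \<in> topspace A" "0 \<le> snd p" "snd p \<le> 1" using bA[OF that(3)] by auto
      then show "fst p \<in> topspace A" "0 \<le> ?k s (snd p)" "?k s (snd p) \<le> 1" using k01 that by auto
      show "?k s (snd p) = 0 \<or> ?k s (snd p) = 1 \<or> fst p = a0" using that by (auto simp: loop_base_def)
    qed (use x0 that in auto)
    ultimately show "continuous_map \<I> ?Z
        (\<lambda>s. \<lambda>n\<in>topspace ?N. u (((fst (fst n), x0), ?k s (snd (fst n))), snd n))"
      using bN by (auto simp: continuous_map_in_subtopology simp del: topspace_prod_topology)
  qed

  have start: "(\<lambda>n\<in>topspace ?N. u (((fst (fst n), x0), ?k 0 (snd (fst n))), snd n))
      = (\<lambda>n\<in>topspace ?N. c (((fst (fst n), x0), snd n), snd (fst n)))"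
  proof (rule restrict_ext)
    fix n :: "('a \<times> real) \<times> 'v"
    show "u (((fst (fst n), x0), ?k 0 (snd (fst n))), snd n) = c (((fst (fst n), x0), snd n), snd (fst n))"
      by (auto simp: c_def loop_cat_def loop_rev_def abs_if)
  qed

  obtain H where H: "continuous_map (prod_topology X \<I>) ?Z H"
    "\<And>x. x \<in> topspace X \<Longrightarrow> H (x, 0) = (\<lambda>n\<in>topspace ?N. c (((fst (fst n), x), snd n), snd (fst n)))"
    "\<And>s. s \<in> {0..1} \<Longrightarrow> H (x0, s) = (\<lambda>n\<in>topspace ?N. u (((fst (fst n), x0), ?k s (snd (fst n))), snd n))"
    using well_pointed_extension[OF X_wp X_Hd f h start] by blast
  let ?E = "\<lambda>p. H (snd (fst (fst (fst p))), snd p) ((fst (fst (fst (fst p))), snd (fst (fst p))), snd (fst p))"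
  have HZ: "H (x, s) (p, v) = b v" if "x \<in> topspace X" "0 \<le> s" "s \<le> 1" "p \<in> loop_base A {a0}" "v \<in> topspace V"
    for x s p v
  proof -
    have "H (x, s) \<in> topspace ?Z"
      using continuous_map_image_subset_topspace[OF H(1)] that by fastforce
    then show ?thesis using that by simp
  qed
  show ?thesis
  proof (rule that[of ?E])
    have e: "continuous_map (prod_topology (prod_topology X \<I>) ?N) Y (\<lambda>p. H (fst p) (snd p))"
      by (rule continuous_map_uncurry[OF continuous_map_into_fulltopology[OF H(1)] N])
    have "continuous_map (prod_topology (prod_topology (prod_topology AX \<I>) V) \<I>)
        (prod_topology (prod_topology X \<I>) ?N)
        (\<lambda>p. ((snd (fst (fst (fst p))), snd p), ((fst (fst (fst (fst p))), snd (fst (fst p))), snd (fst p))))"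
      by (rule cont_intros)+
    from continuous_map_compose'[OF this e]
    show "continuous_map (prod_topology (prod_topology (prod_topology AX \<I>) V) \<I>) Y ?E" by simp
  next
    fix p v and s :: real assume p: "p \<in> loop_base AX fibre" and v: "v \<in> topspace V" and s: "0 \<le> s" "s \<le> 1"
    obtain a x t where "p = ((a, x), t)" by (cases p) auto
    with p v s show "?E ((p, v), s) = b v"
      using HZ[of x s "(a, t)" v] by (auto simp: loop_base_def)
  next
    fix p v assume "p \<in> topspace (prod_topology AX \<I>)" "v \<in> topspace V"
    then show "?E ((p, v), 0) = loop_cat (\<lambda>p. u (p, v)) (loop_rev (\<lambda>p. u (((fst (fst p), x0), snd p), v))) p"
      by (auto simp: H(2) c_def loop_cat_def loop_rev_def)
  next
    fix a v and s t :: real assume "a \<in> topspace A" "0 \<le> t" "t \<le> 1" "v \<in> topspace V" "0 \<le> s" "s \<le> 1"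
    then show "?E ((((a, x0), t), v), s) = u (((a, x0), ?k s t), v)"
      by (simp add: H(3))
  qed
qed

section \<open>The exact sequence\<close>

text \<open>
  An action of \<open>(A \<times> X) \<times> I\<close> on \<open>Y\<close> acts on a map \<open>m\<close> by acting on each value \<open>m x\<close> with the parameter \<open>x\<close>.
  Since \<open>k\<close> has to be trivial only over \<open>fibre\<close>, the lemma serves the smash product and the section alike.
\<close>

lemma gottlieb_adj:
  assumes k: "continuous_map (prod_topology (prod_topology AX \<I>) Y) Y k"
    and k_base: "\<And>p y. p \<in> loop_base AX fibre \<Longrightarrow> y \<in> topspace Y \<Longrightarrow> k (p, y) = y"
  shows "base.loop_class M m0 (adj (\<lambda>p. k (p, y0))) \<in> carrier (gottlieb A a0 M m0)"
proof (rule base.gottliebI(1)[OF m0_in])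
  let ?K = "\<lambda>q. \<lambda>x\<in>topspace X. k (((fst (fst q), x), snd (fst q)), snd q x)"
  have fix_M: "?K (p, m) = m" if "p \<in> loop_base A {a0}" "m \<in> topspace M" for p m
  proof (rule extensionalityI[OF _ M_extensional[OF that(2)]])
    fix x assume x: "x \<in> topspace X"
    then have "k (((fst p, x), snd p), m x) = m x"
      using k_base loop_base_fibre_iff[OF x, of "fst p" "snd p"] that M_apply by simp
    then show "?K (p, m) x = m x" using x by simp
  qed simp
  have e: "continuous_map (prod_topology M X) Y (\<lambda>p. fst p (snd p))"
    using continuous_map_uncurry_M[OF continuous_map_id] by simp
  let ?P = "prod_topology (prod_topology (prod_topology A \<I>) M) X"
  have "continuous_map ?P (prod_topology M X) (\<lambda>p. (snd (fst p), snd p))"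
    by (rule cont_intros)+
  from continuous_map_compose'[OF this e]
  have m: "continuous_map ?P Y (\<lambda>p. snd (fst p) (snd p))" by simp
  have "continuous_map ?P (prod_topology AX \<I>) (\<lambda>p. ((fst (fst (fst p)), snd p), snd (fst (fst p))))"
    by (rule cont_intros)+
  from continuous_map_curry[OF continuous_map_compose'[OF continuous_map_pairedI[OF this m] k]]
  have c: "continuous_map (prod_topology (prod_topology A \<I>) M) (compact_open X Y) ?K"
    by simp
  have "path_component_of (compact_open X Y) m0 (?K ((a, t), m))"
    if a: "a \<in> topspace A" and t: "t \<in> {0..1}" and m: "m \<in> topspace M" for a t m
  proof -
    let ?h = "\<lambda>p. ?K ((fst (fst p), snd p), snd (fst p))"
    have "continuous_map (prod_topology (prod_topology A M) \<I>) (prod_topology (prod_topology A \<I>) M)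
        (\<lambda>p. ((fst (fst p), snd p), snd (fst p)))"
      by (rule cont_intros)+
    from continuous_map_compose'[OF this c]
    have h: "continuous_map (prod_topology (prod_topology A M) \<I>) (compact_open X Y) ?h" .
    have "?h ((a, m), 0) = m"
      using fix_M[of "(a, 0)" m] a m by (simp add: loop_base_def)
    then have "path_component_of (compact_open X Y) m0 (?h ((a, m), 0))"
      using m by (simp add: map_null_def)
    moreover have "(a, m) \<in> topspace (prod_topology A M)" using a m by simp
    ultimately have "path_component_of (compact_open X Y) m0 (?h ((a, m), t))"
      using path_component_slide[OF h _ _ t] by blast
    then show ?thesis by (simp only: fst_conv snd_conv)
  qed
  with c show "continuous_map (prod_topology (prod_topology A \<I>) M) M ?K"
    unfolding map_null_def by (auto simp: continuous_map_in_subtopology)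
  show "?K (p, m0) = adj (\<lambda>p. k (p, y0)) p" for p
    by (auto simp: adj_def const_map_def)
  show "?K (p, m) = m" if "p \<in> loop_base A {a0}" "m \<in> topspace M" for p m
    by (rule fix_M[OF that])
qed

lemma gottlieb_const_map:
  assumes F: "F \<in> loops A {a0} (aut1 Y) (id_map Y)"
  shows "base.loop_class M m0 (\<lambda>p. const_map X (F p y0)) \<in> carrier (gottlieb A a0 M m0)"
proof -
  have e: "continuous_map (prod_topology (prod_topology A \<I>) Y) Y (\<lambda>p. F (fst p) (snd p))"
    by (rule continuous_map_uncurry[OF continuous_map_aut1[OF loops_continuous[OF F]] Y_lc Y_Hd])
  let ?k = "\<lambda>q. F (fst (fst (fst q)), snd (fst q)) (snd q)"
  have "continuous_map (prod_topology (prod_topology AX \<I>) Y) (prod_topology (prod_topology A \<I>) Y)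
     (\<lambda>q. ((fst (fst (fst q)), snd (fst q)), snd q))"
    by (rule cont_intros)+
  from continuous_map_compose'[OF this e]
  have k: "continuous_map (prod_topology (prod_topology AX \<I>) Y) Y ?k" by simp
  have "?k (p, y) = y" if "p \<in> loop_base AX fibre" "y \<in> topspace Y" for p y
    using loops_aut1_at_base[OF F _ that(2), of "(fst (fst p), snd p)"] that(1) by (auto simp: loop_base_def)
  from gottlieb_adj[OF k this] show ?thesis
    by (simp add: adj_def[abs_def] const_map_def)
qed

lemma gottlieb_action:
  assumes G: "G \<in> loops A {a0} (aut1 M) (id_map M)"
  shows "continuous_map (prod_topology (prod_topology A \<I>) Y) M (\<lambda>q. G (fst q) (const_map X (snd q)))"
  by (rule continuous_map_eval_along[OF continuous_map_aut1[OF loops_continuous[OF G]]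
        continuous_map_const_map Y_lc Y_Hd])

lemma gottlieb_action_base:
  assumes "G \<in> loops A {a0} (aut1 M) (id_map M)" "p \<in> loop_base A {a0}" "y \<in> topspace Y"
  shows "G p (const_map X y) = const_map X y"
  by (rule loops_aut1_at_base[OF assms(1,2)])
    (use continuous_map_image_subset_topspace[OF continuous_map_const_map] assms(3) in blast)

lemma gottlieb_eval:
  assumes G: "G \<in> loops A {a0} (aut1 M) (id_map M)"
  shows "base.loop_class Y y0 (\<lambda>p. G p m0 x0) \<in> carrier (gottlieb A a0 Y y0)"
proof (rule base.gottliebI(1)[OF y0])
  show "continuous_map (prod_topology (prod_topology A \<I>) Y) Y (\<lambda>q. G (fst q) (const_map X (snd q)) x0)"
    by (rule continuous_map_compose'[OF gottlieb_action[OF G] continuous_map_eval_M[OF x0]])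
qed (use gottlieb_action_base[OF G] x0 in \<open>auto simp: const_map_def\<close>)

text \<open>
  The action \<open>G(a, t)(C\<^sub>y)(x)\<close> is reduced along \<open>x0\<close>, with \<open>y\<close> as parameter so that the result is again an
  action.  The curried class changes by the inverse of the class of \<open>C\<close> applied to \<open>G(a, t)(m0)(x0)\<close>,
  which is trivial by \<open>null\<close>.
\<close>

lemma gottlieb_kernel:
  assumes G: "G \<in> loops A {a0} (aut1 M) (id_map M)"
    and null: "loop_homotopic A {a0} Y y0 (\<lambda>p. G p m0 x0) (\<lambda>_. y0)"
  obtains u where "u \<in> loops AX wedge Y y0"
    "smash.loop_class Y y0 u \<in> carrier (gottlieb (smash A a0 X x0) wedge Y y0)"
    "loop_homotopic A {a0} M m0 (adj u) (\<lambda>p. G p m0)"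
proof -
  let ?w = "\<lambda>q. G (fst (fst (fst q)), snd (fst q)) (const_map X (snd q)) (snd (fst (fst q)))"
  have "continuous_map (prod_topology (prod_topology AX \<I>) Y) (prod_topology (prod_topology (prod_topology A \<I>) Y) X)
     (\<lambda>q. (((fst (fst (fst q)), snd (fst q)), snd q), snd (fst (fst q))))"
    by (rule cont_intros)+
  from continuous_map_compose'[OF this continuous_map_uncurry_M[OF gottlieb_action[OF G]]]
  have w: "continuous_map (prod_topology (prod_topology AX \<I>) Y) Y ?w" by simp
  have w_base: "?w (p, y) = y" if "p \<in> loop_base AX fibre" "y \<in> topspace Y" for p y
    using gottlieb_action_base[OF G _ that(2), of "(fst (fst p), snd p)"] that
    by (auto simp: loop_base_def const_map_def)
  obtain E where E: "continuous_map (prod_topology (prod_topology (prod_topology AX \<I>) Y) \<I>) Y E"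
    "\<And>p y s. p \<in> loop_base AX fibre \<Longrightarrow> y \<in> topspace Y \<Longrightarrow> 0 \<le> s \<Longrightarrow> s \<le> 1 \<Longrightarrow> E ((p, y), s) = y"
    "\<And>p y. p \<in> topspace (prod_topology AX \<I>) \<Longrightarrow> y \<in> topspace Y \<Longrightarrow>
       E ((p, y), 0) = loop_cat (\<lambda>p. ?w (p, y)) (loop_rev (\<lambda>p. ?w (((fst (fst p), x0), snd p), y))) p"
    "\<And>a t y s. a \<in> topspace A \<Longrightarrow> 0 \<le> t \<Longrightarrow> t \<le> 1 \<Longrightarrow> y \<in> topspace Y \<Longrightarrow> 0 \<le> s \<Longrightarrow> s \<le> 1 \<Longrightarrow>
       E ((((a, x0), t), y), s) = ?w (((a, x0), (1 - s) * (1 - \<bar>1 - 2 * t\<bar>)), y)"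
    by (rule reduce_along_basepoint[OF Y_lc Y_Hd w, of "\<lambda>y. y"]) (use w_base in auto)
  let ?u = "\<lambda>p. E ((p, y0), 1)"
  \<comment> \<open>Over \<open>x0\<close> the contraction ends at the value of \<open>?w\<close> at time \<open>0\<close>, where the action is trivial.\<close>
  have E_wedge: "E ((p, y), 1) = y" if p: "p \<in> loop_base AX wedge" and y: "y \<in> topspace Y" for p y
  proof (cases "p \<in> loop_base AX fibre")
    case True
    then show ?thesis using E(2) y by simp
  next
    case False
    then obtain a t where a: "p = ((a, x0), t)" "a \<in> topspace A" "0 \<le> t" "t \<le> 1"
      using p by (auto simp: loop_base_def smash_base_def)
    have "((a, x0), 0) \<in> loop_base AX fibre" using a x0 by (auto simp: loop_base_def)
    from w_base[OF this y] show ?thesis using E(4)[OF a(2,3,4) y, of 1] a(1) by simp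
  qed
  have "continuous_map (prod_topology (prod_topology AX \<I>) Y) (prod_topology (prod_topology (prod_topology AX \<I>) Y) \<I>)
      (\<lambda>q. (q, 1))"
    by (intro continuous_map_pairedI) (auto simp: continuous_map_unit_interval)
  note k = continuous_map_compose'[OF this E(1)]
  note u = smash.gottliebI[OF y0 k E_wedge refl]
  have "continuous_map (prod_topology (prod_topology AX \<I>) \<I>) (prod_topology (prod_topology (prod_topology AX \<I>) Y) \<I>)
      (\<lambda>q. ((fst q, y0), snd q))"
    by (intro continuous_map_pairedI continuous_map_fst continuous_map_snd) (simp add: y0)
  note c = continuous_map_compose'[OF this E(1)]
  have "loop_homotopic AX fibre Y y0
      (loop_cat (\<lambda>p. ?w (p, y0)) (loop_rev (\<lambda>p. ?w (((fst (fst p), x0), snd p), y0)))) ?u"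
    by (rule loop_homotopicI[OF fibre_subset c]) (use E(2) E(3)[OF _ y0] y0 in auto)
  from adj_homotopic[OF this]
  have h: "loop_homotopic A {a0} M m0 (loop_cat (adj (\<lambda>p. ?w (p, y0)))
      (adj (loop_rev (\<lambda>p. ?w (((fst (fst p), x0), snd p), y0))))) (adj ?u)"
    by (simp only: adj_loop_cat)
  have g: "(\<lambda>p. G p m0) \<in> loops A {a0} M m0" by (rule base.gottlieb_loops[OF m0_in G])
  have "G p m0 = adj (\<lambda>p. ?w (p, y0)) p" if "p \<in> topspace (prod_topology A \<I>)" for p
  proof -
    have "G p m0 \<in> topspace M"
      using continuous_map_image_subset_topspace[OF loops_continuous[OF g]] that by blast
    from extensional_restrict[OF M_extensional[OF this]] show ?thesis by (simp add: adj_def)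
  qed
  note g1 = base.loop_class_cong(2)[OF g this]
  have r: "adj (loop_rev (\<lambda>p. ?w (((fst (fst p), x0), snd p), y0))) = loop_rev (\<lambda>p. const_map X (G p m0 x0))"
    by (auto simp: adj_def loop_rev_def const_map_def fun_eq_iff)
  have "loop_homotopic A {a0} M m0 (\<lambda>p. const_map X (G p m0 x0)) (\<lambda>_. m0)"
    by (rule loop_homotopic_compose[OF null continuous_map_const_map refl])
  from loop_homotopic_rev[OF base.S_subset this]
  have "loop_homotopic A {a0} M m0 (loop_rev (\<lambda>p. const_map X (G p m0 x0))) (\<lambda>_. m0)"
    by (simp only: loop_rev_const)
  with g1 have "loop_homotopic A {a0} M m0 (loop_cat (\<lambda>p. G p m0) (\<lambda>_. m0))
     (loop_cat (adj (\<lambda>p. ?w (p, y0))) (adj (loop_rev (\<lambda>p. ?w (((fst (fst p), x0), snd p), y0)))))"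
    unfolding r by (intro loop_homotopic_cat[OF base.S_subset]) (auto intro: loop_homotopic_sym)
  with loop_cat_const_right[OF base.S_subset g] h
  have "loop_homotopic A {a0} M m0 (adj ?u) (\<lambda>p. G p m0)"
    by (blast intro: loop_homotopic_trans loop_homotopic_sym)
  from that[OF u(2,1) this] show ?thesis by simp
qed

text \<open>
  The uncurried homotopy \<open>H\<close> is reduced along \<open>x0\<close>, with its time as parameter.  At both ends \<open>H\<close> is
  trivial over \<open>x0\<close>, so reduction only multiplies by a constant loop there.
\<close>

lemma adj_injective:
  assumes u: "u \<in> loops AX wedge Y y0" and v: "v \<in> loops AX wedge Y y0"
    and uv: "loop_homotopic A {a0} M m0 (adj u) (adj v)"
  shows "loop_homotopic AX wedge Y y0 u v"
proof -
  obtain H where H: "continuous_map (prod_topology (prod_topology AX \<I>) \<I>) Y H"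
    "\<And>p s. p \<in> loop_base AX fibre \<Longrightarrow> 0 \<le> s \<Longrightarrow> s \<le> 1 \<Longrightarrow> H (p, s) = y0"
    "\<And>p. H (p, 0) = coadj (adj u) p" "\<And>p. H (p, 1) = coadj (adj v) p"
    using loop_homotopicE[OF coadj_homotopic[OF uv]] by blast
  obtain E where E: "continuous_map (prod_topology (prod_topology (prod_topology AX \<I>) \<I>) \<I>) Y E"
    "\<And>p s r. p \<in> loop_base AX fibre \<Longrightarrow> s \<in> topspace \<I> \<Longrightarrow> 0 \<le> r \<Longrightarrow> r \<le> 1 \<Longrightarrow> E ((p, s), r) = y0"
    "\<And>p s. p \<in> topspace (prod_topology AX \<I>) \<Longrightarrow> s \<in> topspace \<I> \<Longrightarrow>
       E ((p, s), 0) = loop_cat (\<lambda>p. H (p, s)) (loop_rev (\<lambda>p. H (((fst (fst p), x0), snd p), s))) p"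
    "\<And>a t s r. a \<in> topspace A \<Longrightarrow> 0 \<le> t \<Longrightarrow> t \<le> 1 \<Longrightarrow> s \<in> topspace \<I> \<Longrightarrow> 0 \<le> r \<Longrightarrow> r \<le> 1 \<Longrightarrow>
       E ((((a, x0), t), s), r) = H (((a, x0), (1 - r) * (1 - \<bar>1 - 2 * t\<bar>)), s)"
    by (rule reduce_along_basepoint[OF locally_compact_space_unit_interval Hausdorff_space_unit_interval H(1),
        of "\<lambda>_. y0"]) (use H(2) in auto)
  have wedge_cases: "(\<And>a t. p = ((a, x0), t) \<Longrightarrow> a \<in> topspace A \<Longrightarrow> 0 \<le> t \<Longrightarrow> t \<le> 1 \<Longrightarrow> P) \<Longrightarrow> P"
    if "p \<in> loop_base AX wedge" "p \<notin> loop_base AX fibre" for p P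
    using that by (auto simp: loop_base_def smash_base_def)

  \<comment> \<open>At an end \<open>s\<close> of the homotopy, \<open>r \<mapsto> E((_, s), r)\<close> connects \<open>z\<close> times a constant loop to the reduced loop.\<close>
  have side: "loop_homotopic AX wedge Y y0 z (\<lambda>p. E ((p, s), 1))"
    if z: "z \<in> loops AX wedge Y y0" and s: "s \<in> {0..1}" and Hs: "\<And>p. H (p, s) = coadj (adj z) p" for z s
  proof -
    have Hz: "H (p, s) = z p" if "p \<in> topspace (prod_topology AX \<I>)" for p
      using that by (cases p) (auto simp: Hs coadj_adj)
    have z0: "z ((a, x0), t) = y0" if "a \<in> topspace A" "0 \<le> t" "t \<le> 1" for a t
      by (rule loops_at_S[OF z _ that(2,3)]) (use that in \<open>auto simp: smash_base_def\<close>)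
    have "continuous_map (prod_topology (prod_topology AX \<I>) \<I>) (prod_topology (prod_topology (prod_topology AX \<I>) \<I>) \<I>)
        (\<lambda>q. ((fst q, s), snd q))"
      by (intro continuous_map_pairedI continuous_map_fst continuous_map_snd) (use s in simp)
    note c = continuous_map_compose'[OF this E(1)]
    have "loop_homotopic AX wedge Y y0 (loop_cat z (\<lambda>_. y0)) (\<lambda>p. E ((p, s), 1))"
    proof (rule loop_homotopicI[OF smash.S_subset c])
      fix p and r :: real assume p: "p \<in> loop_base AX wedge" and r: "0 \<le> r" "r \<le> 1"
      show "E ((fst (p, r), s), snd (p, r)) = y0"
      proof (cases "p \<in> loop_base AX fibre")
        case True
        then show ?thesis using E(2) s r by simp
      next
        case False
        then obtain a t where a: "p = ((a, x0), t)" "a \<in> topspace A" "0 \<le> t" "t \<le> 1"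
          using wedge_cases[OF p] by metis
        have "0 \<le> (1 - r) * (1 - \<bar>1 - 2 * t\<bar>)" "(1 - r) * (1 - \<bar>1 - 2 * t\<bar>) \<le> 1"
          using r a(3,4) by (auto intro!: mult_nonneg_nonneg mult_le_one)
        then show ?thesis
          using E(4)[OF a(2,3,4), of s r] s r a x0 z0 Hz by simp
      qed
    next
      fix q t assume q: "q \<in> topspace AX" and t: "0 \<le> t" "t \<le> (1::real)"
      have "E ((fst ((q, t), 0), s), snd ((q, t), 0))
          = loop_cat (\<lambda>p. H (p, s)) (loop_rev (\<lambda>p. H (((fst (fst p), x0), snd p), s))) (q, t)"
        using E(3)[of "(q, t)" s] q t s by simp
      also have "\<dots> = loop_cat z (\<lambda>_. y0) (q, t)"
        using q t x0 by (cases q) (auto simp: loop_cat_def loop_rev_def Hz z0)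
      finally show "E ((fst ((q, t), 0), s), snd ((q, t), 0)) = loop_cat z (\<lambda>_. y0) (q, t)" .
    qed simp
    with loop_cat_const_right[OF smash.S_subset z] show ?thesis
      by (blast intro: loop_homotopic_trans loop_homotopic_sym)
  qed

  have "continuous_map (prod_topology (prod_topology AX \<I>) \<I>) (prod_topology (prod_topology (prod_topology AX \<I>) \<I>) \<I>)
      (\<lambda>q. (q, 1))"
    by (intro continuous_map_pairedI) (auto simp: continuous_map_unit_interval)
  note c = continuous_map_compose'[OF this E(1)]
  have "loop_homotopic AX wedge Y y0 (\<lambda>p. E ((p, 0), 1)) (\<lambda>p. E ((p, 1), 1))"
  proof (rule loop_homotopicI[OF smash.S_subset c])
    fix p and s :: real assume p: "p \<in> loop_base AX wedge" and s: "0 \<le> s" "s \<le> 1"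
    show "E ((p, s), 1) = y0"
    proof (cases "p \<in> loop_base AX fibre")
      case True
      then show ?thesis using E(2) s by simp
    next
      case False
      then obtain a t where a: "p = ((a, x0), t)" "a \<in> topspace A" "0 \<le> t" "t \<le> 1"
        using wedge_cases[OF p] by metis
      have "((a, x0), 0) \<in> loop_base AX fibre" using a x0 by (auto simp: loop_base_def)
      from H(2)[OF this s] show ?thesis using E(4)[OF a(2,3,4), of s 1] a(1) s by simp
    qed
  qed auto
  with side[OF u _ H(3)] side[OF v _ H(4)] show ?thesis
    by (auto intro: loop_homotopic_trans loop_homotopic_sym)
qed

abbreviation \<G>_smash :: "((('a \<times> 'x) set \<times> real) set \<Rightarrow> 'y) set monoid"
  where "\<G>_smash \<equiv> gottlieb (smash A a0 X x0) wedge Y y0"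
abbreviation \<G>_map :: "(('a \<times> real) set \<Rightarrow> 'x \<Rightarrow> 'y) set monoid"
  where "\<G>_map \<equiv> gottlieb A a0 M m0"
abbreviation \<G>_target :: "(('a \<times> real) set \<Rightarrow> 'y) set monoid"
  where "\<G>_target \<equiv> gottlieb A a0 Y y0"

text \<open>
  Currying on homotopy classes; the choice of the loop is immaterial by \<open>adj_class_loop_class\<close>.
\<close>

definition adj_class ::
    "((('a \<times> 'x) set \<times> real) set \<Rightarrow> 'y) set \<Rightarrow> (('a \<times> real) set \<Rightarrow> 'x \<Rightarrow> 'y) set" where
  "adj_class c =
     base.loop_class M m0 (adj (SOME u. u \<in> loops AX wedge Y y0 \<and> smash.loop_class Y y0 u = c))"

lemma adj_class_loop_class:
  assumes u: "u \<in> loops AX wedge Y y0"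
  shows "adj_class (smash.loop_class Y y0 u) = base.loop_class M m0 (adj u)"
proof -
  let ?v = "SOME v. v \<in> loops AX wedge Y y0 \<and> smash.loop_class Y y0 v = smash.loop_class Y y0 u"
  have "?v \<in> loops AX wedge Y y0 \<and> smash.loop_class Y y0 ?v = smash.loop_class Y y0 u"
    by (rule someI[of _ u]) (simp add: u)
  then have "loop_homotopic AX wedge Y y0 ?v u"
    using smash.loop_class_eqD[OF u] by blast
  from base.loop_class_eqI[OF adj_homotopic[OF loop_homotopic_mono[OF this fibre_wedge]]]
  show ?thesis by (simp add: adj_class_def)
qed

lemma gottlieb_smashE:
  assumes "c \<in> carrier \<G>_smash"
  obtains F where "F \<in> loops AX wedge (aut1 Y) (id_map Y)"
    "(\<lambda>p. F p y0) \<in> loops AX wedge Y y0" "c = smash.loop_class Y y0 (\<lambda>p. F p y0)"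
  using assms smash.gottlieb_loops[OF y0] by (auto simp: smash.carrier_gottlieb[OF y0])

lemma gottlieb_mapE:
  assumes "c \<in> carrier \<G>_map"
  obtains G where "G \<in> loops A {a0} (aut1 M) (id_map M)"
    "(\<lambda>p. G p m0) \<in> loops A {a0} M m0" "c = base.loop_class M m0 (\<lambda>p. G p m0)"
  using assms base.gottlieb_loops[OF m0_in] by (auto simp: base.carrier_gottlieb[OF m0_in])

lemma gottlieb_targetE:
  assumes "c \<in> carrier \<G>_target"
  obtains F where "F \<in> loops A {a0} (aut1 Y) (id_map Y)"
    "(\<lambda>p. F p y0) \<in> loops A {a0} Y y0" "c = base.loop_class Y y0 (\<lambda>p. F p y0)"
  using assms base.gottlieb_loops[OF y0] by (auto simp: base.carrier_gottlieb[OF y0])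

lemma mon_adj_class: "adj_class \<in> mon \<G>_smash \<G>_map"
proof -
  have "adj_class c \<in> carrier \<G>_map" if "c \<in> carrier \<G>_smash" for c
  proof -
    obtain F where F: "F \<in> loops AX wedge (aut1 Y) (id_map Y)"
      "(\<lambda>p. F p y0) \<in> loops AX wedge Y y0" "c = smash.loop_class Y y0 (\<lambda>p. F p y0)"
      using gottlieb_smashE[OF \<open>c \<in> carrier \<G>_smash\<close>] .
    have k: "continuous_map (prod_topology (prod_topology AX \<I>) Y) Y (\<lambda>q. F (fst q) (snd q))"
      by (rule continuous_map_uncurry[OF continuous_map_aut1[OF loops_continuous[OF F(1)]] Y_lc Y_Hd])
    have "F p y = y" if "p \<in> loop_base AX fibre" "y \<in> topspace Y" for p y
      by (rule loops_aut1_at_base[OF F(1) _ that(2)]) (use that(1) fibre_wedge in \<open>auto simp: loop_base_def\<close>)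
    with gottlieb_adj[OF k] show ?thesis
      by (simp add: F(3) adj_class_loop_class[OF F(2)])
  qed
  moreover have "adj_class (c \<otimes>\<^bsub>\<G>_smash\<^esub> d) = adj_class c \<otimes>\<^bsub>\<G>_map\<^esub> adj_class d"
    if c: "c \<in> carrier \<G>_smash" and d: "d \<in> carrier \<G>_smash" for c d
  proof -
    obtain u where u: "u \<in> loops AX wedge Y y0" "c = smash.loop_class Y y0 u"
      using gottlieb_smashE[OF c] by metis
    obtain v where v: "v \<in> loops AX wedge Y y0" "d = smash.loop_class Y y0 v"
      using gottlieb_smashE[OF d] by metis
    have "adj u \<in> loops A {a0} M m0" "adj v \<in> loops A {a0} M m0"
      using u v loops_wedge_fibre by (auto intro: adj_loops)
    then show ?thesis
      using u v by (simp add: smash.gottlieb_mult base.gottlieb_mult smash.mult_susp_group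
          base.mult_susp_group adj_class_loop_class loops_cat adj_loop_cat)
  qed
  moreover have "inj_on adj_class (carrier \<G>_smash)"
  proof (rule inj_onI)
    fix c d assume c: "c \<in> carrier \<G>_smash" and d: "d \<in> carrier \<G>_smash" and eq: "adj_class c = adj_class d"
    obtain u where u: "u \<in> loops AX wedge Y y0" "c = smash.loop_class Y y0 u"
      using gottlieb_smashE[OF c] by metis
    obtain v where v: "v \<in> loops AX wedge Y y0" "d = smash.loop_class Y y0 v"
      using gottlieb_smashE[OF d] by metis
    have "adj v \<in> loops A {a0} M m0"
      using v loops_wedge_fibre by (auto intro: adj_loops)
    then have "loop_homotopic A {a0} M m0 (adj u) (adj v)"
      using eq by (intro base.loop_class_eqD) (simp_all add: u v adj_class_loop_class)
    from smash.loop_class_eqI[OF adj_injective[OF u(1) v(1) this]] show "c = d"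
      by (simp add: u v)
  qed
  ultimately show ?thesis by (auto simp: mon_def intro!: homI)
qed

lemma eval_loop_class:
  "u \<in> loops A {a0} M m0 \<Longrightarrow>
     susp_induced A a0 Y y0 (\<lambda>g. g x0) (base.loop_class M m0 u) = base.loop_class Y y0 (\<lambda>p. u p x0)"
  by (rule base.susp_induced_loop_class[OF _ continuous_map_eval_M[OF x0]]) (simp_all add: const_map_def x0)

lemma const_map_loop_class:
  "u \<in> loops A {a0} Y y0 \<Longrightarrow>
     susp_induced A a0 M m0 (const_map X) (base.loop_class Y y0 u) = base.loop_class M m0 (\<lambda>p. const_map X (u p))"
  by (rule base.susp_induced_loop_class[OF _ continuous_map_const_map refl])

lemma hom_eval: "susp_induced A a0 Y y0 (\<lambda>g. g x0) \<in> hom \<G>_map \<G>_target"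
proof (rule homI)
  fix c assume "c \<in> carrier \<G>_map"
  then show "susp_induced A a0 Y y0 (\<lambda>g. g x0) c \<in> carrier \<G>_target"
    by (rule gottlieb_mapE) (simp add: eval_loop_class gottlieb_eval)
next
  fix c d assume "c \<in> carrier \<G>_map" "d \<in> carrier \<G>_map"
  moreover have "susp_induced A a0 Y y0 (\<lambda>g. g x0) \<in> hom (susp_group A a0 M m0) (susp_group A a0 Y y0)"
    by (rule base.hom_susp_induced[OF continuous_map_eval_M[OF x0]]) (simp add: const_map_def x0)
  ultimately show "susp_induced A a0 Y y0 (\<lambda>g. g x0) (c \<otimes>\<^bsub>\<G>_map\<^esub> d)
      = susp_induced A a0 Y y0 (\<lambda>g. g x0) c \<otimes>\<^bsub>\<G>_target\<^esub> susp_induced A a0 Y y0 (\<lambda>g. g x0) d"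
    using subgroup.subset[OF base.subgroup_gottlieb[OF m0_in]]
    by (simp add: base.gottlieb_mult hom_mult subset_iff)
qed

lemma hom_const_map: "susp_induced A a0 M m0 (const_map X) \<in> hom \<G>_target \<G>_map"
proof (rule homI)
  fix c assume "c \<in> carrier \<G>_target"
  then show "susp_induced A a0 M m0 (const_map X) c \<in> carrier \<G>_map"
    by (rule gottlieb_targetE) (simp add: const_map_loop_class gottlieb_const_map)
next
  fix c d assume "c \<in> carrier \<G>_target" "d \<in> carrier \<G>_target"
  moreover have "susp_induced A a0 M m0 (const_map X) \<in> hom (susp_group A a0 Y y0) (susp_group A a0 M m0)"
    by (rule base.hom_susp_induced[OF continuous_map_const_map refl])
  ultimately show "susp_induced A a0 M m0 (const_map X) (c \<otimes>\<^bsub>\<G>_target\<^esub> d)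
      = susp_induced A a0 M m0 (const_map X) c \<otimes>\<^bsub>\<G>_map\<^esub> susp_induced A a0 M m0 (const_map X) d"
    using subgroup.subset[OF base.subgroup_gottlieb[OF y0]]
    by (simp add: base.gottlieb_mult hom_mult subset_iff)
qed

lemma eval_const_map:
  assumes "c \<in> carrier \<G>_target"
  shows "susp_induced A a0 Y y0 (\<lambda>g. g x0) (susp_induced A a0 M m0 (const_map X) c) = c"
proof -
  obtain u where u: "u \<in> loops A {a0} Y y0" "c = base.loop_class Y y0 u"
    using gottlieb_targetE[OF assms] by metis
  have "(\<lambda>p. const_map X (u p)) \<in> loops A {a0} M m0"
    by (rule loops_compose[OF u(1) continuous_map_const_map refl])
  then show ?thesis
    using u by (simp add: const_map_loop_class eval_loop_class) (simp add: const_map_def x0)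
qed

text \<open>
  A curried loop evaluates at \<open>x0\<close> to a constant because \<open>A \<times> {x0}\<close> lies in the wedge; the other inclusion
  is \<open>gottlieb_kernel\<close>.
\<close>

lemma image_adj_class:
  "adj_class ` carrier \<G>_smash = kernel \<G>_map \<G>_target (susp_induced A a0 Y y0 (\<lambda>g. g x0))"
proof
  show "adj_class ` carrier \<G>_smash \<subseteq> kernel \<G>_map \<G>_target (susp_induced A a0 Y y0 (\<lambda>g. g x0))"
  proof clarify
    fix c assume c: "c \<in> carrier \<G>_smash"
    then obtain u where u: "u \<in> loops AX wedge Y y0" "c = smash.loop_class Y y0 u"
      using gottlieb_smashE by metis
    have adj: "adj u \<in> loops A {a0} M m0"
      using u loops_wedge_fibre by (auto intro: adj_loops)
    have "y0 = adj u p x0" if "p \<in> topspace (prod_topology A \<I>)" for p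
    proof -
      have "u ((fst p, x0), snd p) = y0"
        by (rule loops_at_S[OF u(1)]) (use that in \<open>auto simp: smash_base_def\<close>)
      then show ?thesis by (simp add: adj_def x0)
    qed
    from base.loop_class_cong(3)[OF loops_const[OF y0] this]
    have "susp_induced A a0 Y y0 (\<lambda>g. g x0) (adj_class c) = \<one>\<^bsub>\<G>_target\<^esub>"
      using u adj by (simp add: adj_class_loop_class eval_loop_class base.gottlieb_one base.one_susp_group)
    moreover have "adj_class c \<in> carrier \<G>_map"
      using mon_adj_class c by (auto simp: mon_def dest: hom_in_carrier)
    ultimately show "adj_class c \<in> kernel \<G>_map \<G>_target (susp_induced A a0 Y y0 (\<lambda>g. g x0))"
      by (simp add: kernel_def)
  qed
next
  show "kernel \<G>_map \<G>_target (susp_induced A a0 Y y0 (\<lambda>g. g x0)) \<subseteq> adj_class ` carrier \<G>_smash"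
  proof
    fix c assume "c \<in> kernel \<G>_map \<G>_target (susp_induced A a0 Y y0 (\<lambda>g. g x0))"
    then have c: "c \<in> carrier \<G>_map" "susp_induced A a0 Y y0 (\<lambda>g. g x0) c = base.loop_class Y y0 (\<lambda>_. y0)"
      by (auto simp: kernel_def base.gottlieb_one base.one_susp_group)
    obtain G where G: "G \<in> loops A {a0} (aut1 M) (id_map M)"
      "(\<lambda>p. G p m0) \<in> loops A {a0} M m0" "c = base.loop_class M m0 (\<lambda>p. G p m0)"
      using gottlieb_mapE[OF c(1)] .
    have "loop_homotopic A {a0} Y y0 (\<lambda>p. G p m0 x0) (\<lambda>_. y0)"
      using c(2) by (intro base.loop_class_eqD loops_const y0) (simp add: G(3) eval_loop_class[OF G(2)])
    from gottlieb_kernel[OF G(1) this] obtain u where u: "u \<in> loops AX wedge Y y0"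
      "smash.loop_class Y y0 u \<in> carrier \<G>_smash" "loop_homotopic A {a0} M m0 (adj u) (\<lambda>p. G p m0)" .
    show "c \<in> adj_class ` carrier \<G>_smash"
      by (rule image_eqI[OF _ u(2)]) (simp add: adj_class_loop_class[OF u(1)] G(3) base.loop_class_eqI[OF u(3)])
  qed
qed

lemma split_exact_sequence:
  "split_short_exact \<G>_smash \<G>_map \<G>_target adj_class
     (susp_induced A a0 Y y0 (\<lambda>g. g x0)) (susp_induced A a0 M m0 (const_map X))"
proof -
  have "susp_induced A a0 Y y0 (\<lambda>g. g x0) ` carrier \<G>_map = carrier \<G>_target"
  proof
    show "susp_induced A a0 Y y0 (\<lambda>g. g x0) ` carrier \<G>_map \<subseteq> carrier \<G>_target"
      using hom_in_carrier[OF hom_eval] by blast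
    show "carrier \<G>_target \<subseteq> susp_induced A a0 Y y0 (\<lambda>g. g x0) ` carrier \<G>_map"
    proof
      fix c assume c: "c \<in> carrier \<G>_target"
      show "c \<in> susp_induced A a0 Y y0 (\<lambda>g. g x0) ` carrier \<G>_map"
        using imageI[OF hom_in_carrier[OF hom_const_map c], of "susp_induced A a0 Y y0 (\<lambda>g. g x0)"]
          eval_const_map[OF c] by simp
    qed
  qed
  then show ?thesis
    unfolding split_short_exact_def epi_def
    using mon_adj_class hom_eval image_adj_class hom_const_map eval_const_map by simp
qed

end

theorem theorem2p3:
  fixes X :: "'a topology" and Y :: "'b topology" and A :: "'c topology"
    and x0 :: 'a and y0 :: 'b and a0 :: 'c
  assumes "locally_compact_space X" "Hausdorff_space X" "well_pointed X x0"
    and "locally_compact_space Y" "Hausdorff_space Y" "well_pointed Y y0"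
    and "locally_compact_space A" "Hausdorff_space A" "well_pointed A a0"
    and "connected_space X" "path_connected_space Y"
  defines "M \<equiv> map_null X Y y0" and "m0 \<equiv> const_map X y0"
  defines "ev_star \<equiv> susp_induced A a0 Y y0 (\<lambda>g. g x0)"
    and "\<sigma>_star \<equiv> susp_induced A a0 M m0 (const_map X)"
  shows "comm_group (gottlieb (smash A a0 X x0) (smash_base A a0 X x0) Y y0) \<and>
         comm_group (gottlieb A a0 M m0) \<and>
         comm_group (gottlieb A a0 Y y0) \<and>
         (\<exists>i. split_short_exact
                (gottlieb (smash A a0 X x0) (smash_base A a0 X x0) Y y0)
                (gottlieb A a0 M m0)
                (gottlieb A a0 Y y0)
                i ev_star \<sigma>_star)"
proof -
  interpret gottlieb_mapping_space X Y A x0 y0 a0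
    using assms(1-11) by unfold_locales (auto simp: well_pointed_def)
  show ?thesis
    unfolding M_def m0_def ev_star_def \<sigma>_star_def
    using smash.comm_group_gottlieb[OF y0] base.comm_group_gottlieb[OF m0_in]
      base.comm_group_gottlieb[OF y0] split_exact_sequence by blast
qed

end
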